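(* Suppose that the gradient of the energy is Lipschitz continuous on the Stiefel manifold, i.e. there is $L_0>0$ with $\|\nabla E(U)-\nabla E(V)\|_F\le L_0\|U-V\|_F$ for all $U,V\in\mathcal M^N_{N_g}$. Let $[U^\ast]$ be a local minimizer of $E$ and suppose there are $\delta_1>0$, $\nu_1>0$ such that $\nabla^2_GE(U)[D,D]\ge\nu_1\|D\|_F^2$ for all $[U]\in B([U^\ast],\delta_1)$ and all $D\in\mathcal T_{[U]}\mathcal G^N_{N_g}$. Suppose that the operator $\mathrm{ortho}(U,D,t)$ in the Newton method with adaptive step size strategy (described in the context) is chosen such that, for some constant $C_1>0$, $$\|\mathrm{ortho}(U,D,t)-U\|_F\le C_1t\|D\|_F,\qquad \Big\|\frac{\partial}{\partial t}\mathrm{ortho}(U,D,t)-D\Big\|_F\le C_1t\|D\|_F^2,\qquad \forall\,t\ge 0 .$$ Let $\delta_2$ and the level set $\mathcal L$ be as in the context. If $[U_0]\in B([U^\ast],\delta_2)\cap\mathcal L$, then there exist sequences $\{\sigma_n\}_{n\in\mathbb N_0}\subset(0,1)$ and $\{\theta_n\}_{n\in\mathbb N_0}\subset(0,1)$ such that for the sequence $\{U_n\}_{n\in\mathbb N_0}$ generated by the Newton method with adaptive step size strategy, there holds either $\|\nabla_GE(U_n)\|_F=0$ for some positive integer $n$, or $$\lim_{n\to\infty}\|\nabla_GE(U_n)\|_F=0 .$$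
   Context: Energy. Let $N, N_g$ be positive integers (typically $N_g\gg N$) and $\mathcal M^N_{N_g}=\{U\in\mathbb R^{N_g\times N}:U^TU=I_N\}$ (Stiefel manifold). The discretized Kohn–Sham energy is $$E(U)=\tfrac12\mathrm{tr}(U^TLU)+\mathrm{tr}(U^TV_{ext}U)+\tfrac12\mathrm{tr}(\rho(U)^TL^\dagger\rho(U))+\mathrm{tr}(\rho(U)^T\varepsilon_{xc}(\rho(U))),\quad \rho(U)=\mathrm{diag}(UU^T),$$ where $L\in\mathbb R^{N_g\times N_g}$ is the discretized Laplace operator, $V_{ext}\in\mathbb R^{N_g\times N_g}$ the discretized external potential, $L^\dagger$ the generalized inverse of $L$, and $\varepsilon_{xc}$ the discretized exchange-correlation term; $\mathrm{diag}(A)$ is the column vector of diagonal entries of $A$ and $\mathrm{Diag}(u)$ the diagonal matrix with $u$ on its diagonal. $E$ is assumed smooth enough. One has $E(UP)=E(U)$ for every orthogonal $P$. Let $$\mathcal H(U)=\tfrac12L+V_{ext}+\mathrm{Diag}(L^\dagger\rho(U))+\mathrm{Diag}(v_{xc}(\rho(U))),\quad v_{xc}(\rho)=\frac{\delta(\rho\varepsilon_{xc}(\rho))}{\delta\rho},$$ which is symmetric. The gradient of $E$ in $\mathbb R^{N_g\times N}$ is denoted $\nabla E(U)=\mathcal H(U)U$, and the second order derivative is $\nabla^2E(U)[D]=\mathcal H(U)D+2\,\mathrm{Diag}(J\,\mathrm{diag}(DU^T))U$ with $J=L^\dagger+\frac{\delta^2(\rho\varepsilon_{xc}(\rho))}{\delta\rho^2}$.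 Geometry. $\mathcal O^N$ is the set of orthogonal $N\times N$ matrices, $[U]=\{UP:P\in\mathcal O^N\}$, and $\mathcal G^N_{N_g}=\mathcal M^N_{N_g}/\!\sim$ is the Grassmann manifold of classes $[U]$. Tangent spaces: $\mathcal T_{[U]}\mathcal G^N_{N_g}=\{W\in\mathbb R^{N_g\times N}:W^TU=0\}$ and $\mathcal T_U\mathcal M^N_{N_g}=\{W\in\mathbb R^{N_g\times N}:W^TU+U^TW=0\}$. $\langle A,B\rangle=\mathrm{tr}(A^TB)$ and $\|\cdot\|_F$ is the Frobenius norm. $I$ is the identity of order $N_g$. Grassmann gradient: $\nabla_GE(U)=(I-UU^T)\nabla E(U)$. Grassmann Hessian, for $D,D_1,D_2\in\mathcal T_{[U]}\mathcal G^N_{N_g}$: $\nabla_G^2E(U)[D]=(I-UU^T)\nabla^2E(U)[D]-D\Sigma$ with $\Sigma=U^T\nabla E(U)$, and $\nabla_G^2E(U)[D_1,D_2]=\langle\nabla_G^2E(U)[D_1],D_2\rangle$. $\mathrm{dist}_F([U],[V])=\min_{P\in\mathcal O^N}\|U-VP\|_F$ and $B([U],\delta)=\{[V]\in\mathcal G^N_{N_g}:\mathrm{dist}_F([V],[U])\le\delta\}$. Constants. $C_0>0$ is a constant with $\|\nabla E(\Psi)\|_F\le C_0$ for all $\Psi\in\mathcal M^N_{N_g}$ (it exists by the Lipschitz hypothesis), and $L_1=L_0+2C_0$. $\delta_2$ is any number in $\big(0,\delta_1/(1+\tfrac{3C_1}{\nu_1}L_1)\big)$, and $E_0>E(U^\ast)$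 is such that the level set $\mathcal L=\{[U]\in\mathcal G^N_{N_g}:E(U)\le E_0\}$ satisfies $\mathcal L\cap B([U^\ast],\delta_1)\subset B([U^\ast],\delta_2)$ (such an $E_0$ exists). Retraction. $\mathrm{ortho}(U,D,t)\in\mathcal M^N_{N_g}$ denotes one step from $U\in\mathcal M^N_{N_g}$ with search direction $D$ and step size $t$; it is a retraction, i.e. a smooth map with $\mathrm{ortho}(U,D,0)=U$ and $\frac{\partial}{\partial t}\mathrm{ortho}(U,D,0)=D$. The same symbol is used for the retraction in the inner conjugate gradient method below, where the directions are tangent to the Stiefel manifold. Inner conjugate gradient method (at outer iterate $U_n$). Let $$\bar E_n(U)=\langle\nabla_GE(U_n),(I-U_nU_n^T)U\rangle+\tfrac12\nabla_G^2E(U_n)[(I-U_nU_n^T)U,(I-U_nU_n^T)U],$$ $\nabla\bar E_n(U)=\nabla_GE(U_n)+\nabla_G^2E(U_n)[(I-U_nU_n^T)U]$, $\nabla_S\bar E_n(U)=\nabla\bar E_n(U)-U\nabla\bar E_n(U)^TU$, and, writing $G=\nabla\bar E_n(U_n)$, $$\nabla_S^2\bar E_n(U)[\delta U_1,\delta U_2]=\nabla_G^2E(U_n)[(I-U_nU_n^T)\delta U_1,\delta U_2]+\tfrac12\mathrm{tr}\big((G^T\delta U_1U^T+U^T\delta U_1G^T)\delta U_2\big)-\tfrac12\mathrm{tr}\big((U^TG+G^TU)\delta U_1^T(I-UU^T)\delta U_2\big).$$ The method aims at minimizing $\bar E_n$ over $\mathcal M^N_{N_g}$. Given $\gamma_1,\gamma_2,q\in(0,1)$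 and $U^{(0)}\in\mathcal M^N_{N_g}$, put $\delta U^{(0)}=-\nabla_S\bar E_n(U^{(0)})$, $k=0$. While not converged: (a) if $\langle\delta U^{(k)},\nabla_S\bar E_n(U^{(k)})\rangle>0$, replace $\delta U^{(k)}$ by $-\delta U^{(k)}$; (b) if $-\langle\delta U^{(k)},\nabla_S\bar E_n(U^{(k)})\rangle/\|\nabla_S\bar E_n(U^{(k)})\|_F^2<\gamma_1$, set $\delta U^{(k)}=-\nabla_S\bar E_n(U^{(k)})$; (c) compute $$\alpha^{(k)}=\frac{-\langle\delta U^{(k)},\nabla_S\bar E_n(U^{(k)})\rangle}{\nabla_S^2\bar E_n(U_n)[(I-U_nU_n^T)\delta U^{(k)},\delta U^{(k)}]}$$ and $U^{(k+1)}=\mathrm{ortho}(U^{(k)},\delta U^{(k)},\alpha^{(k)})$; (d) if $\bar E_n(U^{(k+1)})-\bar E_n(U^{(k)})\ge\gamma_2\alpha^{(k)}\langle\delta U^{(k)},\nabla_S\bar E_n(U^{(k)})\rangle$, replace $\alpha^{(k)}$ by $q\alpha^{(k)}$ and update $U^{(k+1)}=\mathrm{ortho}(U^{(k)},\delta U^{(k)},\alpha^{(k)})$; (e) set $\beta^{(k)}=\|\nabla_S\bar E_n(U^{(k+1)})\|_F^2/\|\nabla_S\bar E_n(U^{(k)})\|_F^2$, $\delta U^{(k+1)}=-\nabla_S\bar E_n(U^{(k+1)})+\beta^{(k)}(I-U^{(k+1)}{U^{(k+1)}}^T)\delta U^{(k)}$, and $k=k+1$. Return $D=(I-U_nU_n^T)U^{(k)}$.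 Adaptive step size strategy, with inputs $(U,D,t^{\rm initial},t_{\min},\eta,\theta)$: set $t=\min\big(\max(t^{\rm initial},t_{\min}),\theta/\|D\|_F\big)$ and compute $$\zeta(t)=\frac{\langle\nabla_GE(U),D\rangle+\frac t2\nabla_G^2E(U)[D,D]}{\langle\nabla_GE(U),D\rangle}.$$ If $\zeta(t)<\eta$, choose instead $t=\min\Big(-\frac{\langle\nabla_GE(U),D\rangle}{\nabla_G^2E(U)[D,D]},\frac{\theta}{\|D\|_F}\Big)$ when $\nabla_G^2E(U)[D,D]>0$, and $t=\theta/\|D\|_F$ otherwise. Return $t$. Newton method with adaptive step size strategy. Given $\epsilon,\gamma_1,\gamma_2,q\in(0,1)$, $\eta\in(0,\frac12)$ and $U_0$ with $U_0^TU_0=I_N$, let $n=0$. While $\|\nabla_GE(U_n)\|_F>\epsilon$: choose suitable $\sigma_n,\theta_n\in(0,1)$; solve for $D_n\in\mathcal T_{[U_n]}\mathcal G^N_{N_g}$ by the inner conjugate gradient method above such that $\|\nabla_G^2E(U_n)[D_n]+\nabla_GE(U_n)\|_F\le\sigma_n\|\nabla_GE(U_n)\|_F$; let $t_n$ be the output of the adaptive step size strategy with inputs $(U_n,D_n,t_n^{\rm init},10^{-2},\eta,\theta_n)$, where $t_n^{\rm init}=-\langle\nabla_GE(U_n),D_n\rangle/\nabla_G^2E(U_n)[D_n,D_n]$; update $U_{n+1}=\mathrm{ortho}(U_n,D_n,t_n)$; let $n=n+1$. *)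

theory Defs
  imports "HOL-Analysis.Analysis"
begin

text \<open>
  Matrices with \<open>N\<^sub>g\<close> rows and \<open>N\<close> columns are elements of \<open>real^'n^'g\<close>, with
  \<open>N = CARD('n)\<close> and \<open>N\<^sub>g = CARD('g)\<close>. On this type \<open>\<bullet>\<close> and \<open>norm\<close> are the Frobenius
  inner product and norm:
\<close>

lemma inner_eq_trace:
  fixes A B :: "real^'n^'g"
  shows "A \<bullet> B = trace (transpose A ** B)"
proof -
  have "A \<bullet> B = (\<Sum>i\<in>UNIV. \<Sum>j\<in>UNIV. A $ i $ j * B $ i $ j)"
    by (simp add: inner_vec_def)
  also have "\<dots> = (\<Sum>j\<in>UNIV. \<Sum>i\<in>UNIV. A $ i $ j * B $ i $ j)"
    by (rule sum.swap)
  also have "\<dots> = trace (transpose A ** B)"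
    by (simp add: trace_def matrix_matrix_mult_def transpose_def)
  finally show ?thesis .
qed

lemma norm_eq_frobenius:
  fixes A :: "real^'n^'g"
  shows "norm A = sqrt (trace (transpose A ** A))"
  by (simp add: norm_eq_sqrt_inner inner_eq_trace)


section \<open>Smoothness\<close>

text \<open>Intended for open \<open>S\<close> in a finite-dimensional space.\<close>

primrec C_k_on :: "nat \<Rightarrow> 'a::real_normed_vector set \<Rightarrow> ('a \<Rightarrow> 'b::real_normed_vector) \<Rightarrow> bool" where
  "C_k_on 0 S f \<longleftrightarrow> continuous_on S f"
| "C_k_on (Suc k) S f \<longleftrightarrow> (\<forall>x\<in>S. f differentiable (at x)) \<and>
     (\<forall>v. C_k_on k S (\<lambda>x. frechet_derivative f (at x) v))"

text \<open>Smoothness on an arbitrary subset: local extendability to a smooth map on an open set.\<close>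

definition smooth_map_on :: "'a::real_normed_vector set \<Rightarrow> ('a \<Rightarrow> 'b::real_normed_vector) \<Rightarrow> bool" where
  "smooth_map_on S f \<longleftrightarrow>
     (\<forall>x\<in>S. \<exists>W F. open W \<and> x \<in> W \<and> (\<forall>k. C_k_on k W F) \<and> (\<forall>y\<in>W \<inter> S. F y = f y))"


section \<open>The discretized Kohn--Sham energy\<close>

definition diag_vec :: "real^'g^'g \<Rightarrow> real^'g" where
  "diag_vec A = (\<chi> i. A $ i $ i)"

definition diag_mat :: "real^'g \<Rightarrow> real^'g^'g" where
  "diag_mat u = (\<chi> i j. if i = j then u $ i else 0)"

text \<open>The Penrose equations, which characterize the generalized inverse \<open>X = A\<^sup>\<dagger>\<close> uniquely.\<close>

definition is_generalized_inverse :: "real^'g^'g \<Rightarrow> real^'g^'g \<Rightarrow> bool" where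
  "is_generalized_inverse A X \<longleftrightarrow>
     A ** X ** A = A \<and> X ** A ** X = X \<and>
     transpose (A ** X) = A ** X \<and> transpose (X ** A) = X ** A"

text \<open>
  The exchange-correlation term is an arbitrary map of the whole density vector; a local
  density functional is the special case in which it acts componentwise.
\<close>

record 'g kohn_sham =
  lap :: "real^'g^'g"
  lap_dag :: "real^'g^'g"
  v_ext :: "real^'g^'g"
  eps_xc :: "real^'g \<Rightarrow> real^'g"

definition density :: "real^'n^'g \<Rightarrow> real^'g" where
  "density U = diag_vec (U ** transpose U)"

definition energy :: "'g kohn_sham \<Rightarrow> real^'n^'g \<Rightarrow> real" where
  "energy K U =
     1/2 * trace (transpose U ** lap K ** U) + trace (transpose U ** v_ext K ** U)
     + 1/2 * (density U \<bullet> (lap_dag K *v density U)) + density U \<bullet> eps_xc K (density U)"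

definition xc_energy :: "'g kohn_sham \<Rightarrow> real^'g \<Rightarrow> real" where
  "xc_energy K r = r \<bullet> eps_xc K r"

definition v_xc :: "'g kohn_sham \<Rightarrow> real^'g \<Rightarrow> real^'g" where
  "v_xc K r = (\<chi> i. frechet_derivative (xc_energy K) (at r) (axis i 1))"

definition xc_hessian :: "'g kohn_sham \<Rightarrow> real^'g \<Rightarrow> real^'g^'g" where
  "xc_hessian K r = matrix (frechet_derivative (v_xc K) (at r))"

definition hamiltonian :: "'g kohn_sham \<Rightarrow> real^'n^'g \<Rightarrow> real^'g^'g" where
  "hamiltonian K U =
     (1/2) *\<^sub>R lap K + v_ext K + diag_mat (lap_dag K *v density U) + diag_mat (v_xc K (density U))"

text \<open>
  Following the source, \<open>\<nabla>E(U)\<close> denotes \<open>\<H>(U)U\<close>. With the normalization of \<open>\<H>\<close> above this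
  is one half of the Euclidean gradient of \<open>energy\<close>; \<open>hess_E\<close> is the derivative of
  \<open>grad_E\<close>, so all first and second order quantities carry the same factor.
\<close>

definition grad_E :: "'g kohn_sham \<Rightarrow> real^'n^'g \<Rightarrow> real^'n^'g" where
  "grad_E K U = hamiltonian K U ** U"

definition hess_E :: "'g kohn_sham \<Rightarrow> real^'n^'g \<Rightarrow> real^'n^'g \<Rightarrow> real^'n^'g" where
  "hess_E K U D =
     hamiltonian K U ** D
     + 2 *\<^sub>R (diag_mat ((lap_dag K + xc_hessian K (density U)) *v diag_vec (D ** transpose U)) ** U)"


section \<open>Stiefel and Grassmann manifolds\<close>

definition stiefel :: "(real^'n^'g) set" where
  "stiefel = {U. transpose U ** U = mat 1}"

definition grass_class :: "real^'n^'g \<Rightarrow> (real^'n^'g) set" where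
  "grass_class U = {U ** P | P. orthogonal_matrix P}"

definition tangent_grass :: "real^'n^'g \<Rightarrow> (real^'n^'g) set" where
  "tangent_grass U = {W. transpose W ** U = 0}"

definition tangent_stiefel :: "real^'n^'g \<Rightarrow> (real^'n^'g) set" where
  "tangent_stiefel U = {W. transpose W ** U + transpose U ** W = 0}"

text \<open>\<open>dist_F([U],[V])\<close> in terms of representatives; the infimum is attained by compactness
  of the orthogonal group.\<close>

definition dist_F :: "real^'n^'g \<Rightarrow> real^'n^'g \<Rightarrow> real" where
  "dist_F U V = (INF P\<in>{P. orthogonal_matrix P}. norm (U - V ** P))"

definition grass_ball :: "real^'n^'g \<Rightarrow> real \<Rightarrow> (real^'n^'g) set set" where
  "grass_ball U r = {grass_class V | V. V \<in> stiefel \<and> dist_F V U \<le> r}"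

definition level_set :: "'g kohn_sham \<Rightarrow> real \<Rightarrow> (real^'n^'g) set set" where
  "level_set K e = {grass_class V | V. V \<in> stiefel \<and> energy K V \<le> e}"

definition local_minimizer :: "'g kohn_sham \<Rightarrow> real^'n^'g \<Rightarrow> bool" where
  "local_minimizer K U \<longleftrightarrow>
     U \<in> stiefel \<and>
     (\<exists>r>0. \<forall>V\<in>stiefel. grass_class V \<in> grass_ball U r \<longrightarrow> energy K U \<le> energy K V)"

definition proj :: "real^'n^'g \<Rightarrow> real^'n^'g \<Rightarrow> real^'n^'g" where
  "proj U X = (mat 1 - U ** transpose U) ** X"

definition grad_G :: "'g kohn_sham \<Rightarrow> real^'n^'g \<Rightarrow> real^'n^'g" where
  "grad_G K U = proj U (grad_E K U)"

definition hess_G :: "'g kohn_sham \<Rightarrow> real^'n^'g \<Rightarrow> real^'n^'g \<Rightarrow> real^'n^'g" where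
  "hess_G K U D = proj U (hess_E K U D) - D ** (transpose U ** grad_E K U)"

definition hess_G2 :: "'g kohn_sham \<Rightarrow> real^'n^'g \<Rightarrow> real^'n^'g \<Rightarrow> real^'n^'g \<Rightarrow> real" where
  "hess_G2 K U D1 D2 = hess_G K U D1 \<bullet> D2"

text \<open>The step size ranges over all of \<open>\<real>\<close>: the inner method does not
  enforce positive step sizes.\<close>

definition retraction_map :: "(real^'n^'g \<Rightarrow> real^'n^'g \<Rightarrow> real \<Rightarrow> real^'n^'g) \<Rightarrow> bool" where
  "retraction_map ortho \<longleftrightarrow>
     smooth_map_on {(U, D, t). U \<in> stiefel \<and> D \<in> tangent_stiefel U} (\<lambda>(U, D, t). ortho U D t) \<and>
     (\<forall>U\<in>stiefel. \<forall>D\<in>tangent_stiefel U.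
        (\<forall>t. ortho U D t \<in> stiefel) \<and> ortho U D 0 = U \<and>
        ((\<lambda>t. ortho U D t) has_vector_derivative D) (at 0))"


section \<open>The inner conjugate gradient method\<close>

text \<open>In this section \<open>Uc\<close> is the current outer iterate.\<close>

definition model_E :: "'g kohn_sham \<Rightarrow> real^'n^'g \<Rightarrow> real^'n^'g \<Rightarrow> real" where
  "model_E K Uc U =
     grad_G K Uc \<bullet> proj Uc U + 1/2 * hess_G2 K Uc (proj Uc U) (proj Uc U)"

definition model_grad :: "'g kohn_sham \<Rightarrow> real^'n^'g \<Rightarrow> real^'n^'g \<Rightarrow> real^'n^'g" where
  "model_grad K Uc U = grad_G K Uc + hess_G K Uc (proj Uc U)"

definition model_grad_S :: "'g kohn_sham \<Rightarrow> real^'n^'g \<Rightarrow> real^'n^'g \<Rightarrow> real^'n^'g" where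
  "model_grad_S K Uc U = model_grad K Uc U - U ** transpose (model_grad K Uc U) ** U"

definition model_hess_S ::
  "'g kohn_sham \<Rightarrow> real^'n^'g \<Rightarrow> real^'n^'g \<Rightarrow> real^'n^'g \<Rightarrow> real^'n^'g \<Rightarrow> real" where
  "model_hess_S K Uc U d1 d2 =
     (let G = model_grad K Uc Uc in
        hess_G2 K Uc (proj Uc d1) d2
        + 1/2 * trace ((transpose G ** d1 ** transpose U + transpose U ** d1 ** transpose G) ** d2)
        - 1/2 * trace ((transpose U ** G + transpose G ** U) ** transpose d1
                        ** (mat 1 - U ** transpose U) ** d2))"

text \<open>Steps (a) and (b): sign change and restart, with \<open>g\<close> the current Stiefel gradient.\<close>

definition cg_direction :: "real \<Rightarrow> real^'n^'g \<Rightarrow> real^'n^'g \<Rightarrow> real^'n^'g" where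
  "cg_direction \<gamma>1 g d =
     (let d1 = (if d \<bullet> g > 0 then - d else d)
      in if - (d1 \<bullet> g) / (norm g)^2 < \<gamma>1 then - g else d1)"

text \<open>Step (c).\<close>

definition cg_step_size :: "'g kohn_sham \<Rightarrow> real^'n^'g \<Rightarrow> real^'n^'g \<Rightarrow> real^'n^'g \<Rightarrow> real" where
  "cg_step_size K Uc X d =
     - (d \<bullet> model_grad_S K Uc X) / model_hess_S K Uc Uc (proj Uc d) d"

text \<open>Step (d): a single reduction of the step size.\<close>

definition cg_backtrack ::
  "'g kohn_sham \<Rightarrow> (real^'n^'g \<Rightarrow> real^'n^'g \<Rightarrow> real \<Rightarrow> real^'n^'g) \<Rightarrow> real \<Rightarrow> real \<Rightarrow>
   real^'n^'g \<Rightarrow> real^'n^'g \<Rightarrow> real^'n^'g \<Rightarrow> real \<Rightarrow> real" where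
  "cg_backtrack K ortho \<gamma>2 q Uc X d \<alpha> =
     (if model_E K Uc (ortho X d \<alpha>) - model_E K Uc X \<ge> \<gamma>2 * \<alpha> * (d \<bullet> model_grad_S K Uc X)
      then q * \<alpha> else \<alpha>)"

text \<open>
  \<open>cg_iterate K ortho \<gamma>1 \<gamma>2 q Uc X0 X d\<close>: starting from \<open>U\<^sup>(\<^sup>0\<^sup>) = X0\<close>, some pass of the
  inner loop is entered with \<open>U\<^sup>(\<^sup>k\<^sup>) = X\<close> and \<open>\<delta>U\<^sup>(\<^sup>k\<^sup>) = d\<close>. The loop continues only while the
  quotients it forms have nonzero denominators.
\<close>

inductive cg_iterate ::
  "'g kohn_sham \<Rightarrow> (real^'n^'g \<Rightarrow> real^'n^'g \<Rightarrow> real \<Rightarrow> real^'n^'g) \<Rightarrow> real \<Rightarrow> real \<Rightarrow> real \<Rightarrow>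
   real^'n^'g \<Rightarrow> real^'n^'g \<Rightarrow> real^'n^'g \<Rightarrow> real^'n^'g \<Rightarrow> bool"
  for K ortho \<gamma>1 \<gamma>2 q Uc X0 where
  cg_init: "cg_iterate K ortho \<gamma>1 \<gamma>2 q Uc X0 X0 (- model_grad_S K Uc X0)"
| cg_step: "cg_iterate K ortho \<gamma>1 \<gamma>2 q Uc X0 X' (- model_grad_S K Uc X' + \<beta> *\<^sub>R proj X' d')"
  if "cg_iterate K ortho \<gamma>1 \<gamma>2 q Uc X0 X d"
    and "model_grad_S K Uc X \<noteq> 0"
    and "d' = cg_direction \<gamma>1 (model_grad_S K Uc X) d"
    and "model_hess_S K Uc Uc (proj Uc d') d' \<noteq> 0"
    and "\<alpha> = cg_backtrack K ortho \<gamma>2 q Uc X d' (cg_step_size K Uc X d')"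
    and "X' = ortho X d' \<alpha>"
    and "\<beta> = (norm (model_grad_S K Uc X'))^2 / (norm (model_grad_S K Uc X))^2"

definition cg_output ::
  "'g kohn_sham \<Rightarrow> (real^'n^'g \<Rightarrow> real^'n^'g \<Rightarrow> real \<Rightarrow> real^'n^'g) \<Rightarrow> real \<Rightarrow> real \<Rightarrow> real \<Rightarrow>
   real^'n^'g \<Rightarrow> real^'n^'g \<Rightarrow> bool" where
  "cg_output K ortho \<gamma>1 \<gamma>2 q Uc D \<longleftrightarrow>
     (\<exists>X0\<in>stiefel. \<exists>X d. cg_iterate K ortho \<gamma>1 \<gamma>2 q Uc X0 X d \<and> D = proj Uc X)"


section \<open>The Newton method with adaptive step size strategy\<close>

definition adaptive_step ::
  "'g kohn_sham \<Rightarrow> real^'n^'g \<Rightarrow> real^'n^'g \<Rightarrow> real \<Rightarrow> real \<Rightarrow> real \<Rightarrow> real \<Rightarrow> real" where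
  "adaptive_step K U D t_init t_min \<eta> \<theta> =
     (let s = grad_G K U \<bullet> D;
          h = hess_G2 K U D D;
          t = min (max t_init t_min) (\<theta> / norm D);
          \<zeta> = (s + t / 2 * h) / s
      in if \<zeta> < \<eta>
         then (if h > 0 then min (- s / h) (\<theta> / norm D) else \<theta> / norm D)
         else t)"

text \<open>
  \<open>tol\<close> is the stopping tolerance; a stopped sequence is continued by its last iterate.
  The inner solver may be started anywhere on the Stiefel manifold in each outer iteration.
\<close>

definition newton_sequence ::
  "'g kohn_sham \<Rightarrow> (real^'n^'g \<Rightarrow> real^'n^'g \<Rightarrow> real \<Rightarrow> real^'n^'g) \<Rightarrow> real \<Rightarrow>
   real \<Rightarrow> real \<Rightarrow> real \<Rightarrow> real \<Rightarrow> (nat \<Rightarrow> real) \<Rightarrow> (nat \<Rightarrow> real) \<Rightarrow>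
   real^'n^'g \<Rightarrow> (nat \<Rightarrow> real^'n^'g) \<Rightarrow> bool" where
  "newton_sequence K ortho tol \<gamma>1 \<gamma>2 q \<eta> \<sigma> \<theta> U0 U \<longleftrightarrow>
     U 0 = U0 \<and>
     (\<forall>n. if norm (grad_G K (U n)) > tol
          then \<exists>D\<in>tangent_grass (U n).
                 cg_output K ortho \<gamma>1 \<gamma>2 q (U n) D \<and>
                 norm (hess_G K (U n) D + grad_G K (U n)) \<le> \<sigma> n * norm (grad_G K (U n)) \<and>
                 U (Suc n) = ortho (U n) D
                   (adaptive_step K (U n) D (- (grad_G K (U n) \<bullet> D) / hess_G2 K (U n) D D)
                      (1/100) \<eta> (\<theta> n))
          else U (Suc n) = U n)"

end

theory Submission
  imports Defs
begin

text \<open>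
  Constant sequences \<open>\<sigma>\<close> and \<open>\<theta>\<close>, chosen small enough in terms of the data, make every step
  decrease the energy by a fixed multiple of \<open>t \<parallel>D\<parallel>\<^sup>2\<close>.

  Write \<open>g = grad_G K U\<close>, \<open>s = g \<bullet> D\<close> and \<open>h = hess_G2 K U D D\<close>. Coercivity and the residual
  bound with small \<open>\<sigma>\<close> give \<open>\<bar>s + h\<bar> \<le> h / 2\<close> and \<open>\<parallel>g\<parallel> \<le> 2 \<Lambda> \<parallel>D\<parallel>\<close>, where \<open>\<Lambda>\<close> bounds
  the Hessian on the compact Stiefel manifold (\<open>inexact_newton_direction\<close>). The quadratic model
  \<open>t s + t\<^sup>2 h / 2\<close> is then minimized at \<open>t = - s / h\<close>, between \<open>1/2\<close> and \<open>3/2\<close>; the test on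
  \<open>\<zeta>\<close> never fails and the strategy returns \<open>min (- s / h) (\<theta> / \<parallel>D\<parallel>)\<close>
  (\<open>adaptive_step_newton\<close>), for which the model is at most \<open>t s / 2 \<le> - t \<nu> \<parallel>D\<parallel>\<^sup>2 / 4\<close>.

  The model has to be compared with the energy along \<open>c \<tau> = ortho U D \<tau>\<close>
  (\<open>energy_along_retraction_le\<close>). Since \<open>c\<close> stays on the Stiefel manifold, only the Grassmann
  gradient contributes to the derivative of the energy, which is \<open>2 (grad_G K (c \<tau>) \<bullet> c' \<tau>)\<close>.
  The part \<open>grad_G K (c \<tau>) \<bullet> D\<close> differs from \<open>s + \<tau> h\<close> by at most a small multiple of
  \<open>\<tau> \<parallel>D\<parallel>\<^sup>2\<close>, because the derivative of \<open>grad_G K\<close> is uniformly continuous on the manifold and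
  the step has length at most a constant times \<open>\<theta>\<close>. The remaining part
  \<open>grad_G K (c \<tau>) \<bullet> (c' \<tau> - D)\<close> can be as large as a multiple of \<open>\<parallel>g\<parallel> \<tau> \<parallel>D\<parallel>\<^sup>2\<close>, which is not of higher order
  when \<open>g\<close> is large. The truncation of the step rescues the estimate: \<open>t \<parallel>g\<parallel> \<le> 2 \<Lambda> t \<parallel>D\<parallel> \<le> 2 \<Lambda> \<theta>\<close>.
  Hence one step decreases the energy by at least \<open>\<nu> t \<parallel>D\<parallel>\<^sup>2 / 4\<close> (\<open>newton_step_decrease\<close>).

  If also \<open>C1 \<theta> \<le> \<delta>1 - \<delta>2\<close>, a step from the \<open>\<delta>2\<close>-ball cannot leave the \<open>\<delta>1\<close>-ball, and
  since the energy does not grow, the hypothesis on the level set brings the new iterate back to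
  the \<open>\<delta>2\<close>-ball. So the decrease is available at every iterate; the energy is bounded below, so
  \<open>t \<parallel>D\<parallel>\<^sup>2\<close> tends to zero. As either \<open>t \<ge> 1/2\<close> or \<open>t \<parallel>D\<parallel> = \<theta>\<close>, also \<open>\<parallel>D\<parallel>\<close> and with it
  \<open>\<parallel>g\<parallel>\<close> tend to zero.
\<close>

section \<open>Matrix calculus\<close>

lemma bounded_bilinear_matrix_mult:
  "bounded_bilinear ((**) :: real^'m^'k \<Rightarrow> real^'l^'m \<Rightarrow> real^'l^'k)"
  unfolding bilinear_conv_bounded_bilinear[symmetric] bilinear_def
  by (auto intro!: linearI simp: vec_eq_iff matrix_matrix_mult_def sum.distrib
      sum_distrib_left algebra_simps)

lemma bounded_bilinear_matrix_vector_mult: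
  "bounded_bilinear ((*v) :: real^'m^'k \<Rightarrow> real^'m \<Rightarrow> real^'k)"
  unfolding bilinear_conv_bounded_bilinear[symmetric] bilinear_def
  by (auto intro!: linearI simp: vec_eq_iff matrix_vector_mult_def sum.distrib
      sum_distrib_left algebra_simps)

lemma bounded_linear_transpose:
  "bounded_linear (transpose :: real^'m^'k \<Rightarrow> real^'k^'m)"
  by (auto simp: linear_conv_bounded_linear[symmetric] vec_eq_iff transpose_def intro!: linearI)

lemma bounded_linear_diag_vec: "bounded_linear (diag_vec :: real^'g^'g \<Rightarrow> real^'g)"
  by (auto simp: linear_conv_bounded_linear[symmetric] vec_eq_iff diag_vec_def intro!: linearI)

lemma bounded_linear_diag_mat: "bounded_linear (diag_mat :: real^'g \<Rightarrow> real^'g^'g)"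
  by (auto simp: linear_conv_bounded_linear[symmetric] vec_eq_iff diag_mat_def intro!: linearI)

lemmas matrix_derivative_intros =
  bounded_bilinear.FDERIV[OF bounded_bilinear_matrix_mult]
  bounded_bilinear.FDERIV[OF bounded_bilinear_matrix_vector_mult]
  bounded_linear.has_derivative[OF bounded_linear_transpose]
  bounded_linear.has_derivative[OF bounded_linear_diag_vec]
  bounded_linear.has_derivative[OF bounded_linear_diag_mat]

lemmas matrix_continuous_intros =
  bounded_bilinear.continuous_on[OF bounded_bilinear_matrix_mult]
  bounded_bilinear.continuous_on[OF bounded_bilinear_matrix_vector_mult]
  bounded_linear.continuous_on[OF bounded_linear_transpose]
  bounded_linear.continuous_on[OF bounded_linear_diag_vec]
  bounded_linear.continuous_on[OF bounded_linear_diag_mat]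

lemmas matrix_bilinear_simps =
  bounded_bilinear.add_left[OF bounded_bilinear_matrix_mult]
  bounded_bilinear.add_right[OF bounded_bilinear_matrix_mult]
  bounded_bilinear.diff_left[OF bounded_bilinear_matrix_mult]
  bounded_bilinear.diff_right[OF bounded_bilinear_matrix_mult]
  bounded_bilinear.minus_left[OF bounded_bilinear_matrix_mult]
  bounded_bilinear.minus_right[OF bounded_bilinear_matrix_mult]
  bounded_bilinear.scaleR_left[OF bounded_bilinear_matrix_mult]
  bounded_bilinear.scaleR_right[OF bounded_bilinear_matrix_mult]
  bounded_bilinear.zero_left[OF bounded_bilinear_matrix_mult]
  bounded_bilinear.zero_right[OF bounded_bilinear_matrix_mult]

lemma inner_matrix_mult_right:
  fixes X :: "real^'n^'g" and A :: "real^'m^'g" and B :: "real^'n^'m"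
  shows "X \<bullet> (A ** B) = (transpose A ** X) \<bullet> B"
  by (simp add: inner_eq_trace matrix_transpose_mul matrix_mul_assoc)

lemma inner_transpose: "transpose A \<bullet> transpose B = A \<bullet> (B :: real^'n^'g)"
  unfolding inner_vec_def transpose_def by (simp add: sum.swap[of _ "UNIV::'g set"])

lemma inner_matrix_mult_left:
  fixes X :: "real^'n^'g" and A :: "real^'m^'g" and B :: "real^'n^'m"
  shows "X \<bullet> (A ** B) = (X ** transpose B) \<bullet> A"
proof -
  have "X \<bullet> (A ** B) = transpose X \<bullet> (transpose B ** transpose A)"
    by (metis inner_transpose matrix_transpose_mul)
  also have "\<dots> = (B ** transpose X) \<bullet> transpose A"
    by (simp add: inner_matrix_mult_right)
  also have "\<dots> = (X ** transpose B) \<bullet> A"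
    by (metis inner_transpose matrix_transpose_mul transpose_transpose)
  finally show ?thesis .
qed

lemma norm_mult_orthogonal_matrix:
  fixes X :: "real^'n^'g"
  assumes "orthogonal_matrix P"
  shows "norm (X ** P) = norm X"
proof -
  have "(X ** P) \<bullet> (X ** P) = X \<bullet> X"
    using assms by (simp add: inner_matrix_mult_left orthogonal_matrix_def matrix_mul_assoc[symmetric])
  then show ?thesis by (simp add: norm_eq_sqrt_inner)
qed

lemma inner_antisymmetric_symmetric:
  fixes A S :: "real^'n^'n"
  assumes "transpose A = - A" "transpose S = S"
  shows "A \<bullet> S = 0"
  using inner_transpose[of A S] assms by simp

text \<open>
  The derivative of a functional of the density is of the form on the left; its representing matrix
  is the term that \<open>hamiltonian\<close> applies to \<open>U\<close>.
\<close>

lemma inner_diag_vec: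
  fixes U X :: "real^'n^'g"
  shows "v \<bullet> diag_vec (X ** transpose U) = (diag_mat v ** U) \<bullet> X"
proof -
  have "(diag_mat v ** U) $ i $ j = v $ i * U $ i $ j" for i j
    by (simp add: diag_mat_def matrix_matrix_mult_def if_distrib[of "\<lambda>x. x * _"] cong: if_cong)
  then show ?thesis
    by (simp add: inner_vec_def diag_vec_def matrix_matrix_mult_def[of X] transpose_def
        sum_distrib_left mult_ac)
qed

lemma diag_vec_swap:
  fixes U X :: "real^'n^'g"
  shows "diag_vec (U ** transpose X) = diag_vec (X ** transpose U)"
  by (simp add: vec_eq_iff diag_vec_def matrix_matrix_mult_def transpose_def mult.commute)

lemma transpose_diag_mat: "transpose (diag_mat v) = diag_mat v"
  by (auto simp: vec_eq_iff diag_mat_def transpose_def)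

text \<open>
  \<open>A X\<close> and \<open>A Y\<close> are symmetric projections onto the same column space, hence equal;
  \<open>X A\<close> and \<open>Y A\<close> both project onto the row space.
\<close>

lemma generalized_inverse_unique:
  assumes "is_generalized_inverse A X" "is_generalized_inverse A Y"
  shows "X = Y"
proof -
  note X = assms(1)[unfolded is_generalized_inverse_def]
  note Y = assms(2)[unfolded is_generalized_inverse_def]
  have "A ** X = (A ** Y) ** (A ** X)" using Y by (simp add: matrix_mul_assoc)
  also have "\<dots> = transpose ((A ** X) ** (A ** Y))" using X Y by (simp add: matrix_transpose_mul)
  also have "\<dots> = A ** Y" using X Y by (simp add: matrix_mul_assoc)
  finally have AX: "A ** X = A ** Y" .
  have "X ** A = (X ** A) ** (Y ** A)" using Y by (metis matrix_mul_assoc)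
  also have "\<dots> = transpose ((Y ** A) ** (X ** A))" using X Y by (simp add: matrix_transpose_mul)
  also have "\<dots> = Y ** A" using X Y by (metis matrix_mul_assoc)
  finally have XA: "X ** A = Y ** A" .
  have "X = (X ** A) ** X" using X by simp
  also have "\<dots> = Y ** (A ** X)" by (simp add: XA matrix_mul_assoc)
  also have "\<dots> = Y" using Y by (simp add: AX matrix_mul_assoc)
  finally show ?thesis .
qed

text \<open>
  The transpose of \<open>X\<close> satisfies the Penrose equations for the transpose of \<open>A\<close>. The symmetry is
  needed for \<open>grad_E\<close> to be (half of) the gradient of the Hartree term.
\<close>

lemma generalized_inverse_symmetric:
  assumes "is_generalized_inverse A X" "transpose A = A"
  shows "transpose X = X"
proof -
  note X = assms(1)[unfolded is_generalized_inverse_def]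
  have 1: "A ** transpose X = X ** A" "transpose X ** A = A ** X"
    using X assms(2) by (metis matrix_transpose_mul transpose_transpose)+
  have "A ** transpose X ** A = transpose (A ** X ** A)"
    "transpose X ** A ** transpose X = transpose (X ** A ** X)"
    using assms(2) by (simp_all add: matrix_transpose_mul matrix_mul_assoc)
  then have "is_generalized_inverse A (transpose X)"
    unfolding is_generalized_inverse_def using X assms(2) 1 by simp
  then show ?thesis using assms(1) generalized_inverse_unique by blast
qed

section \<open>The Stiefel and Grassmann manifolds\<close>

lemma compact_stiefel: "compact (stiefel :: (real^'n^'g) set)"
proof -
  have "U \<bullet> U = trace (mat 1 :: real^'n^'n)" if "U \<in> stiefel" for U :: "real^'n^'g"
    using that by (simp add: inner_eq_trace stiefel_def)
  then have "norm U \<le> sqrt (trace (mat 1 :: real^'n^'n))" if "U \<in> stiefel" for U :: "real^'n^'g"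
    using that by (simp add: norm_eq_sqrt_inner)
  then have "bounded (stiefel :: (real^'n^'g) set)"
    unfolding bounded_iff by blast
  moreover have "closed (stiefel :: (real^'n^'g) set)"
    unfolding stiefel_def
    by (intro closed_Collect_eq matrix_continuous_intros continuous_intros)
  ultimately show ?thesis by (simp add: compact_eq_bounded_closed)
qed

lemma stiefel_mult_orthogonal:
  assumes "U \<in> stiefel" "orthogonal_matrix P"
  shows "U ** P \<in> stiefel"
proof -
  have "transpose (U ** P) ** (U ** P) = transpose P ** ((transpose U ** U) ** P)"
    by (simp add: matrix_transpose_mul matrix_mul_assoc)
  then show ?thesis
    using assms by (simp add: stiefel_def orthogonal_matrix_def)
qed

lemma grass_class_eqE:
  assumes "grass_class U = grass_class V"
  obtains P where "orthogonal_matrix P" "V = U ** P"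
proof -
  have "V \<in> grass_class V"
    unfolding grass_class_def using orthogonal_matrix_id by (force intro: exI[of _ "mat 1"])
  then show ?thesis using that assms unfolding grass_class_def by blast
qed

lemma grass_class_mult_orthogonal:
  assumes "orthogonal_matrix P"
  shows "grass_class (U ** P) = grass_class U"
proof (intro set_eqI iffI)
  fix V assume "V \<in> grass_class (U ** P)"
  then show "V \<in> grass_class U"
    unfolding grass_class_def using assms orthogonal_matrix_mul
    by (auto simp: matrix_mul_assoc[symmetric])
next
  fix V assume "V \<in> grass_class U"
  then obtain Q where Q: "orthogonal_matrix Q" "V = U ** Q"
    unfolding grass_class_def by blast
  have "V = U ** P ** (transpose P ** Q)"
    using assms Q unfolding orthogonal_matrix_def by (metis matrix_mul_assoc matrix_mul_lid)
  then show "V \<in> grass_class (U ** P)"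
    unfolding grass_class_def using Q assms
    by (auto intro!: exI[of _ "transpose P ** Q"] orthogonal_matrix_mul)
qed

lemma dist_F_le_add_norm: "dist_F U V \<le> dist_F W V + norm (U - W)"
proof -
  have "dist_F U V - norm (U - W) \<le> norm (W - V ** P)" if "orthogonal_matrix P" for P
  proof -
    have "dist_F U V \<le> norm (U - V ** P)"
      unfolding dist_F_def by (rule cINF_lower) (auto intro!: bdd_belowI[of _ 0] that)
    also have "\<dots> \<le> norm (U - W) + norm (W - V ** P)"
      by (metis norm_triangle_ineq diff_add_cancel add_diff_eq)
    finally show ?thesis by simp
  qed
  then have "dist_F U V - norm (U - W) \<le> dist_F W V"
    unfolding dist_F_def[of W] using orthogonal_matrix_id by (intro cINF_greatest) auto
  then show ?thesis by simp
qed

text \<open>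
  A ball contains a class as soon as one representative is close to the centre. The representative
  \<open>U ** P\<close> that is close for \<open>U\<close> is matched by \<open>V ** P\<close>, since \<open>P\<close> acts isometrically.
\<close>

lemma grass_ball_step:
  assumes "grass_class U \<in> grass_ball C r" "V \<in> stiefel" "norm (V - U) \<le> s"
  shows "grass_class V \<in> grass_ball C (r + s)"
proof -
  obtain W where W: "W \<in> stiefel" "dist_F W C \<le> r" "grass_class U = grass_class W"
    using assms(1) unfolding grass_ball_def by blast
  obtain P where P: "orthogonal_matrix P" "W = U ** P"
    using grass_class_eqE[OF W(3)] by blast
  have "norm (V ** P - W) = norm ((V - U) ** P)"
    by (simp add: P(2) matrix_bilinear_simps)
  then have "norm (V ** P - W) \<le> s"
    using norm_mult_orthogonal_matrix[OF P(1)] assms(3) by metis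
  then have "dist_F (V ** P) C \<le> r + s"
    using dist_F_le_add_norm[of "V ** P" C W] W(2) by simp
  then show ?thesis
    unfolding grass_ball_def
    using stiefel_mult_orthogonal[OF assms(2) P(1)] grass_class_mult_orthogonal[OF P(1)]
    by (intro CollectI exI[of _ "V ** P"]) auto
qed

text \<open>
  The energy depends on \<open>U\<close> only through \<open>U ** transpose U\<close>.
\<close>

lemma energy_mult_orthogonal:
  fixes U :: "real^'n^'g"
  assumes "orthogonal_matrix P"
  shows "energy K (U ** P) = energy K U"
proof -
  have eq: "U ** P ** transpose (U ** P) = U ** transpose U"
    using assms
    by (metis (no_types, opaque_lifting) matrix_mul_assoc matrix_mul_rid matrix_transpose_mul
        orthogonal_matrix_def)
  have "trace (transpose V ** M ** V) = M \<bullet> (V ** transpose V)"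
    for V :: "real^'n^'g" and M :: "real^'g^'g"
  proof -
    have "trace (transpose V ** M ** V) = V \<bullet> (M ** V)"
      by (simp add: inner_eq_trace matrix_mul_assoc)
    also have "\<dots> = M \<bullet> (V ** transpose V)"
      by (metis inner_commute inner_matrix_mult_left)
    finally show ?thesis .
  qed
  then show ?thesis
    by (simp add: energy_def density_def eq)
qed

lemma mem_level_set_iff:
  assumes "U \<in> stiefel"
  shows "grass_class U \<in> level_set K e \<longleftrightarrow> energy K U \<le> e"
proof
  assume "grass_class U \<in> level_set K e"
  then obtain V where "grass_class U = grass_class V" "energy K V \<le> e"
    unfolding level_set_def by blast
  then show "energy K U \<le> e"
    by (metis grass_class_eqE energy_mult_orthogonal)
next
  assume "energy K U \<le> e"
  then show "grass_class U \<in> level_set K e"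
    unfolding level_set_def using assms by blast
qed

lemma tangent_grass_imp_stiefel:
  assumes "D \<in> tangent_grass U"
  shows "D \<in> tangent_stiefel U"
proof -
  have "transpose U ** D = transpose (transpose D ** U)"
    by (simp add: matrix_transpose_mul)
  then show ?thesis
    using assms by (simp add: tangent_grass_def tangent_stiefel_def linear_0
        bounded_linear.linear[OF bounded_linear_transpose])
qed

section \<open>Derivatives of the energy\<close>

text \<open>
  The hypotheses on the model alone, without the geometry. The symmetry of the three matrices makes
  \<open>hamiltonian\<close> symmetric and \<open>grad_E\<close> a gradient field up to a factor.
\<close>

locale smooth_kohn_sham =
  fixes K :: "'g::finite kohn_sham" and \<Omega> :: "(real^'g) set"
  assumes lap_sym: "transpose (lap K) = lap K"
    and v_ext_sym: "transpose (v_ext K) = v_ext K"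
    and lap_dag_sym: "transpose (lap_dag K) = lap_dag K"
    and open_Omega: "open \<Omega>"
    and xc_C2: "C_k_on 2 \<Omega> (xc_energy K)"
begin

lemma xc_energy_has_derivative:
  assumes "r \<in> \<Omega>"
  shows "(xc_energy K has_derivative (\<lambda>y. v_xc K r \<bullet> y)) (at r)"
proof -
  let ?f = "frechet_derivative (xc_energy K) (at r)"
  have f: "(xc_energy K has_derivative ?f) (at r)"
    using xc_C2 assms by (simp add: numeral_2_eq_2 frechet_derivative_works[symmetric])
  then interpret bounded_linear ?f by (rule has_derivative_bounded_linear)
  have "?f y = v_xc K r \<bullet> y" for y
  proof -
    have "?f y = ?f (\<Sum>i\<in>UNIV. y $ i *\<^sub>R axis i 1)"
      using basis_expansion[of y] by (simp add: scalar_mult_eq_scaleR)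
    also have "\<dots> = v_xc K r \<bullet> y"
      by (simp add: sum scaleR v_xc_def inner_vec_def mult.commute)
    finally show ?thesis .
  qed
  then have "?f = (\<lambda>y. v_xc K r \<bullet> y)" by auto
  then show ?thesis using f by simp
qed

lemma v_xc_has_derivative:
  assumes "r \<in> \<Omega>"
  shows "(v_xc K has_derivative (\<lambda>y. xc_hessian K r *v y)) (at r)"
proof -
  have "(\<lambda>s. frechet_derivative (xc_energy K) (at s) (axis i 1)) differentiable (at r)" for i
    using xc_C2 assms by (simp add: numeral_2_eq_2)
  then have "v_xc K differentiable (at r)"
    unfolding differentiable_componentwise_within[of "v_xc K"]
    by (auto simp: Basis_vec_def inner_axis v_xc_def)
  then have "(v_xc K has_derivative frechet_derivative (v_xc K) (at r)) (at r)"
    by (simp add: frechet_derivative_works)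
  then show ?thesis
    by (metis (no_types, lifting) xc_hessian_def matrix_vector_mul(3) has_derivative_bounded_linear)
qed

lemma continuous_on_xc_hessian: "continuous_on \<Omega> (xc_hessian K)"
proof -
  define d2 where "d2 i j r = frechet_derivative
      (\<lambda>s. frechet_derivative (xc_energy K) (at s) (axis i 1)) (at r) (axis j 1)" for i j r
  have "xc_hessian K r $ i $ j = d2 i j r" if "r \<in> \<Omega>" for r i j
  proof -
    have "((\<lambda>s. v_xc K s $ i) has_derivative (\<lambda>y. (xc_hessian K r *v y) $ i)) (at r)"
      using bounded_linear.has_derivative[OF bounded_linear_vec_nth v_xc_has_derivative[OF that]] .
    then have "frechet_derivative (\<lambda>s. v_xc K s $ i) (at r) = (\<lambda>y. (xc_hessian K r *v y) $ i)"
      by (metis frechet_derivative_at)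
    then show ?thesis
      by (simp add: d2_def v_xc_def matrix_vector_mult_basis column_def)
  qed
  moreover have "continuous_on \<Omega> (d2 i j)" for i j
    using xc_C2 by (simp add: numeral_2_eq_2 d2_def[abs_def])
  ultimately have "continuous_on \<Omega> (\<lambda>r. xc_hessian K r $ i $ j)" for i j
    by (simp cong: continuous_on_cong)
  then have "continuous_on \<Omega> (\<lambda>r. \<chi> i j. xc_hessian K r $ i $ j)"
    by (intro continuous_on_vec_lambda)
  then show ?thesis by simp
qed

lemma continuous_on_v_xc: "continuous_on \<Omega> (v_xc K)"
  using v_xc_has_derivative has_derivative_continuous continuous_at_imp_continuous_on by blast

lemma density_has_derivative:
  fixes U :: "real^'n^'g"
  shows "(density has_derivative (\<lambda>X. 2 *\<^sub>R diag_vec (X ** transpose U))) (at U)"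
proof -
  have "(density has_derivative (\<lambda>X. diag_vec (U ** transpose X + X ** transpose U))) (at U)"
    unfolding density_def[abs_def] by (intro matrix_derivative_intros has_derivative_ident)
  then show ?thesis
    by (simp add: linear_add[OF bounded_linear.linear[OF bounded_linear_diag_vec]]
        diag_vec_swap[of U] scaleR_2)
qed

lemma continuous_on_density: "continuous_on S (density :: real^'n^'g \<Rightarrow> _)"
  using density_has_derivative has_derivative_continuous continuous_at_imp_continuous_on by blast

text \<open>
  The factor \<open>2\<close> is the normalization of \<open>hamiltonian\<close>: \<open>grad_E\<close> is half the Euclidean
  gradient.
\<close>

lemma energy_has_derivative:
  fixes U :: "real^'n^'g"
  assumes "density U \<in> \<Omega>"
  shows "(energy K has_derivative (\<lambda>X. 2 * (grad_E K U \<bullet> X))) (at U)"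
proof -
  have quad: "((\<lambda>V. V \<bullet> (A ** V)) has_derivative (\<lambda>X. 2 * ((A ** U) \<bullet> X))) (at U)"
    if "transpose A = A" for A :: "real^'g^'g"
  proof -
    have "((\<lambda>V. V \<bullet> (A ** V)) has_derivative (\<lambda>X. U \<bullet> (A ** X + 0 ** U) + X \<bullet> (A ** U))) (at U)"
      by (intro has_derivative_inner matrix_derivative_intros has_derivative_ident has_derivative_const)
    moreover have "U \<bullet> (A ** X + 0 ** U) + X \<bullet> (A ** U) = 2 * ((A ** U) \<bullet> X)" for X
      using that inner_matrix_mult_right[of U A X]
      by (simp add: matrix_bilinear_simps inner_commute[of X])
    ultimately show ?thesis by simp
  qed
  let ?r = "density U" and ?d = "\<lambda>X. 2 *\<^sub>R diag_vec (X ** transpose U)"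
  note den = density_has_derivative[of U]
  have har: "((\<lambda>V. density V \<bullet> (lap_dag K *v density V)) has_derivative
      (\<lambda>X. 2 * ((lap_dag K *v ?r) \<bullet> ?d X))) (at U)"
  proof -
    have "((\<lambda>V. density V \<bullet> (lap_dag K *v density V)) has_derivative
      (\<lambda>X. ?r \<bullet> (lap_dag K *v ?d X + 0 *v ?r) + ?d X \<bullet> (lap_dag K *v ?r))) (at U)"
      by (intro has_derivative_inner matrix_derivative_intros has_derivative_const den)
    moreover have "?r \<bullet> (lap_dag K *v y) = (lap_dag K *v ?r) \<bullet> y" for y
      using lap_dag_sym dot_lmul_matrix[of ?r "lap_dag K" y]
      by (simp add: transpose_matrix_vector[symmetric])
    moreover have "?d X \<bullet> (lap_dag K *v ?r) = (lap_dag K *v ?r) \<bullet> ?d X" for X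
      by (rule inner_commute)
    ultimately show ?thesis by simp
  qed
  have xc: "((\<lambda>V. xc_energy K (density V)) has_derivative (\<lambda>X. v_xc K ?r \<bullet> ?d X)) (at U)"
    using has_derivative_compose[OF den xc_energy_has_derivative[OF assms]] .
  have energy_eq: "energy K = (\<lambda>V. 1/2 * (V \<bullet> (lap K ** V)) + V \<bullet> (v_ext K ** V)
      + 1/2 * (density V \<bullet> (lap_dag K *v density V)) + xc_energy K (density V))"
    by (rule ext) (simp add: energy_def inner_eq_trace[of V "A ** V" for V A] matrix_mul_assoc xc_energy_def)
  have "(\<dots> has_derivative (\<lambda>X. 1/2 * (2 * ((lap K ** U) \<bullet> X)) + 2 * ((v_ext K ** U) \<bullet> X)
      + 1/2 * (2 * ((lap_dag K *v ?r) \<bullet> ?d X)) + v_xc K ?r \<bullet> ?d X)) (at U)"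
    by (intro has_derivative_add has_derivative_mult_right quad lap_sym v_ext_sym har xc)
  then show ?thesis
    unfolding energy_eq[symmetric]
    by (simp add: grad_E_def hamiltonian_def matrix_bilinear_simps inner_add_left inner_diag_vec
        algebra_simps)
qed

lemma grad_E_has_derivative:
  fixes U :: "real^'n^'g"
  assumes "density U \<in> \<Omega>"
  shows "(grad_E K has_derivative hess_E K U) (at U)"
proof -
  let ?r = "density U" and ?d = "\<lambda>X. 2 *\<^sub>R diag_vec (X ** transpose U)"
  note den = density_has_derivative[of U]
  have "((\<lambda>V. hamiltonian K V ** V) has_derivative
      (\<lambda>X. hamiltonian K U ** X
        + (0 + diag_mat (lap_dag K *v ?d X + 0 *v ?r) + diag_mat (xc_hessian K ?r *v ?d X)) ** U)) (at U)"
    unfolding hamiltonian_def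
    by (intro matrix_derivative_intros has_derivative_add has_derivative_const has_derivative_ident
        den has_derivative_compose[OF den v_xc_has_derivative[OF assms]])
  moreover have "hamiltonian K U ** X
        + (0 + diag_mat (lap_dag K *v ?d X + 0 *v ?r) + diag_mat (xc_hessian K ?r *v ?d X)) ** U
      = hess_E K U X" for X
    by (simp add: hess_E_def matrix_bilinear_simps algebra_simps
        linear_add[OF bounded_linear.linear[OF bounded_linear_diag_mat]]
        linear_scale[OF bounded_linear.linear[OF bounded_linear_diag_mat]])
  ultimately show ?thesis
    by (simp add: grad_E_def[abs_def])
qed

lemma transpose_hamiltonian: "transpose (hamiltonian K U) = hamiltonian K U"
  by (simp add: hamiltonian_def lap_sym v_ext_sym transpose_diag_mat transpose_scalar
      linear_add[OF bounded_linear.linear[OF bounded_linear_transpose]])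

text \<open>
  The symmetry of \<open>\<Sigma> = U\<^sup>T \<nabla>E(U)\<close> is what makes \<open>U \<Sigma>\<close> normal to the Stiefel manifold.
\<close>

lemma transpose_multiplier:
  "transpose (transpose U ** grad_E K U) = transpose U ** grad_E K U"
  by (simp add: grad_E_def matrix_transpose_mul transpose_hamiltonian matrix_mul_assoc)

end

text \<open>
  The Euclidean derivative of the Grassmann gradient. Its difference from the Grassmann Hessian
  lies in the range of \<open>U\<close> and so is invisible to tangent vectors.
\<close>

definition grad_G_deriv :: "'g kohn_sham \<Rightarrow> real^'n^'g \<Rightarrow> real^'n^'g \<Rightarrow> real^'n^'g" where
  "grad_G_deriv K U X = hess_G K U X - U ** transpose X ** grad_E K U"

context smooth_kohn_sham
begin

lemma grad_G_has_derivative: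
  fixes U :: "real^'n^'g"
  assumes "density U \<in> \<Omega>"
  shows "(grad_G K has_derivative grad_G_deriv K U) (at U)"
proof -
  have "((\<lambda>V. (mat 1 - V ** transpose V) ** grad_E K V) has_derivative
     (\<lambda>X. (mat 1 - U ** transpose U) ** hess_E K U X
        + (0 - (U ** transpose X + X ** transpose U)) ** grad_E K U)) (at U)"
    by (intro matrix_derivative_intros has_derivative_diff has_derivative_const has_derivative_ident
        grad_E_has_derivative assms)
  then show ?thesis
    by (simp add: grad_G_def[abs_def] proj_def grad_G_deriv_def[abs_def] hess_G_def
        matrix_bilinear_simps matrix_mul_assoc algebra_simps)
qed

lemma continuous_on_energy:
  "density ` S \<subseteq> \<Omega> \<Longrightarrow> continuous_on S (energy K :: real^'n^'g \<Rightarrow> _)"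
  using energy_has_derivative has_derivative_continuous continuous_at_imp_continuous_on
  by (metis image_subset_iff)

lemma continuous_on_grad_E:
  "density ` S \<subseteq> \<Omega> \<Longrightarrow> continuous_on S (grad_E K :: real^'n^'g \<Rightarrow> _)"
  using grad_E_has_derivative has_derivative_continuous continuous_at_imp_continuous_on
  by (metis image_subset_iff)

lemma continuous_on_grad_G:
  "density ` S \<subseteq> \<Omega> \<Longrightarrow> continuous_on S (grad_G K :: real^'n^'g \<Rightarrow> _)"
  using grad_G_has_derivative has_derivative_continuous continuous_at_imp_continuous_on
  by (metis image_subset_iff)

text \<open>
  Joint continuity in the point and the direction is the form in which compactness of the manifold
  yields bounds that are uniform in both.
\<close>

lemma continuous_on_hess_E:
  fixes S :: "(real^'n^'g) set"
  assumes "density ` S \<subseteq> \<Omega>"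
  shows "continuous_on (S \<times> UNIV) (\<lambda>p. hess_E K (fst p) (snd p))"
proof -
  have den: "continuous_on (S \<times> UNIV) (\<lambda>p :: (real^'n^'g) \<times> (real^'n^'g). density (fst p))"
    by (rule continuous_on_compose2[OF continuous_on_density continuous_on_fst[OF continuous_on_id]]) auto
  have sub: "(\<lambda>p :: (real^'n^'g) \<times> (real^'n^'g). density (fst p)) ` (S \<times> UNIV) \<subseteq> \<Omega>"
    using assms by auto
  show ?thesis
    unfolding hess_E_def hamiltonian_def
    by (intro continuous_intros matrix_continuous_intros den
        continuous_on_compose2[OF continuous_on_v_xc den sub]
        continuous_on_compose2[OF continuous_on_xc_hessian den sub])
qed

lemma continuous_on_hess_G:
  fixes S :: "(real^'n^'g) set"
  assumes "density ` S \<subseteq> \<Omega>"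
  shows "continuous_on (S \<times> UNIV) (\<lambda>p. hess_G K (fst p) (snd p))"
proof -
  have "continuous_on (S \<times> UNIV) (\<lambda>p :: (real^'n^'g) \<times> (real^'n^'g). grad_E K (fst p))"
    by (rule continuous_on_compose2[OF continuous_on_grad_E[OF assms]]) (auto intro!: continuous_intros)
  then show ?thesis
    unfolding hess_G_def proj_def
    by (intro continuous_intros matrix_continuous_intros continuous_on_hess_E assms)
qed

lemma continuous_on_grad_G_deriv:
  fixes S :: "(real^'n^'g) set"
  assumes "density ` S \<subseteq> \<Omega>"
  shows "continuous_on (S \<times> UNIV) (\<lambda>p. grad_G_deriv K (fst p) (snd p))"
proof -
  have "continuous_on (S \<times> UNIV) (\<lambda>p :: (real^'n^'g) \<times> (real^'n^'g). grad_E K (fst p))"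
    by (rule continuous_on_compose2[OF continuous_on_grad_E[OF assms]]) (auto intro!: continuous_intros)
  then show ?thesis
    unfolding grad_G_deriv_def
    by (intro continuous_intros matrix_continuous_intros continuous_on_hess_G assms)
qed

end

section \<open>Uniform estimates over a compact set\<close>

text \<open>
  By homogeneity it suffices to look at unit vectors, that is, at the compact set \<open>S \<times> sphere 0 1\<close>.
  The same reduction gives the next lemma.
\<close>

lemma compact_linear_family_bounded:
  fixes A :: "'a::metric_space \<Rightarrow> 'b::euclidean_space \<Rightarrow> 'c::real_normed_vector"
  assumes "compact S" "continuous_on (S \<times> UNIV) (\<lambda>p. A (fst p) (snd p))"
    and "\<And>x. x \<in> S \<Longrightarrow> linear (A x)"
  obtains B where "B > 0" "\<And>x v. x \<in> S \<Longrightarrow> norm (A x v) \<le> B * norm v"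
proof -
  have "compact ((\<lambda>p. A (fst p) (snd p)) ` (S \<times> sphere 0 1))"
    using assms(1,2) by (intro compact_continuous_image compact_Times)
      (auto elim: continuous_on_subset)
  then obtain B where "B > 0" "\<forall>y\<in>(\<lambda>p. A (fst p) (snd p)) ` (S \<times> sphere 0 1). norm y \<le> B"
    using compact_imp_bounded bounded_pos by metis
  then have B: "B > 0" "\<And>x v. x \<in> S \<Longrightarrow> norm v = 1 \<Longrightarrow> norm (A x v) \<le> B"
    by auto
  have "norm (A x v) \<le> B * norm v" if "x \<in> S" for x v
  proof (cases "v = 0")
    case True
    then show ?thesis using linear_0[OF assms(3)[OF that]] by simp
  next
    case False
    have "A x v = norm v *\<^sub>R A x (sgn v)"
      using False linear_scale[OF assms(3)[OF that], of "norm v" "sgn v"] by (simp add: sgn_div_norm)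
    then show ?thesis
      using B(2)[OF that, of "sgn v"] False by (simp add: norm_sgn mult.commute mult_left_mono)
  qed
  then show ?thesis using that B(1) by blast
qed

lemma compact_linear_family_uniformly_continuous:
  fixes A :: "'a::metric_space \<Rightarrow> 'b::euclidean_space \<Rightarrow> 'c::real_normed_vector"
  assumes "compact S" "continuous_on (S \<times> UNIV) (\<lambda>p. A (fst p) (snd p))"
    and "\<And>x. x \<in> S \<Longrightarrow> linear (A x)" and "e > 0"
  obtains d where "d > 0"
    "\<And>x y v. \<lbrakk>x \<in> S; y \<in> S; dist x y < d\<rbrakk> \<Longrightarrow> norm (A x v - A y v) \<le> e * norm v"
proof -
  have "uniformly_continuous_on (S \<times> sphere 0 1) (\<lambda>p. A (fst p) (snd p))"
    using assms(1,2) by (intro compact_uniformly_continuous compact_Times)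
      (auto elim: continuous_on_subset)
  then obtain d where d: "d > 0"
    "\<And>p p'. \<lbrakk>p \<in> S \<times> sphere 0 1; p' \<in> S \<times> sphere 0 1; dist p' p < d\<rbrakk>
      \<Longrightarrow> dist (A (fst p') (snd p')) (A (fst p) (snd p)) < e"
    unfolding uniformly_continuous_on_def using assms(4) by metis
  have "norm (A x v - A y v) \<le> e * norm v" if xy: "x \<in> S" "y \<in> S" "dist x y < d" for x y v
  proof (cases "v = 0")
    case True
    then show ?thesis using linear_0[OF assms(3)] xy by simp
  next
    case False
    have eq: "A z v = norm v *\<^sub>R A z (sgn v)" if "z \<in> S" for z
      using False linear_scale[OF assms(3)[OF that], of "norm v" "sgn v"] by (simp add: sgn_div_norm)
    have "dist (A x (sgn v)) (A y (sgn v)) < e"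
      using d(2)[of "(y, sgn v)" "(x, sgn v)"] xy False by (simp add: dist_Pair_Pair norm_sgn)
    then have "norm v * norm (A x (sgn v) - A y (sgn v)) \<le> norm v * e"
      by (intro mult_left_mono) (auto simp: dist_norm)
    then show ?thesis
      using xy by (simp add: eq scaleR_diff_right[symmetric] mult.commute)
  qed
  then show ?thesis using that d(1) by blast
qed

section \<open>Curves on the Stiefel manifold\<close>

text \<open>
  Smoothness is given on the set of triples \<open>(U, D, t)\<close>, which is not open; the line in direction
  of \<open>t\<close> stays in it, so a local smooth extension has the same restriction to that line.
\<close>

lemma retraction_has_vector_derivative:
  assumes "retraction_map ortho" "U \<in> stiefel" "D \<in> tangent_stiefel U"
  shows "(ortho U D has_vector_derivative vector_derivative (ortho U D) (at t)) (at t)"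
proof -
  let ?S = "{(U, D, t). U \<in> stiefel \<and> D \<in> tangent_stiefel U}"
  have "smooth_map_on ?S (\<lambda>(U, D, t). ortho U D t)"
    using assms(1) unfolding retraction_map_def by blast
  from bspec[OF this[unfolded smooth_map_on_def], of "(U, D, t)"]
  obtain W F where W: "open W" "(U, D, t) \<in> W" "\<forall>k. C_k_on k W F"
    and F: "\<forall>y\<in>W \<inter> ?S. F y = (\<lambda>(U, D, t). ortho U D t) y"
    using assms(2,3) by auto
  have "F differentiable (at (U, D, t))"
    using spec[OF W(3), of 1] W(2) by simp
  moreover have "((\<lambda>s. (U, D, s)) has_derivative (\<lambda>s. (0, 0, s))) (at t)"
    by (intro has_derivative_Pair has_derivative_const has_derivative_ident)
  ultimately have "(\<lambda>s. F (U, D, s)) differentiable (at t)"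
    unfolding differentiable_def by (auto dest: has_derivative_compose)
  then have "((\<lambda>s. F (U, D, s)) has_vector_derivative vector_derivative (\<lambda>s. F (U, D, s)) (at t)) (at t)"
    using vector_derivative_works by blast
  moreover have "open ((\<lambda>s. (U, D, s)) -` W)"
    by (intro open_vimage W(1) continuous_intros)
  ultimately have "(ortho U D has_vector_derivative vector_derivative (\<lambda>s. F (U, D, s)) (at t)) (at t)"
    by (rule has_vector_derivative_transform_within_open) (use W F assms in auto)
  then show ?thesis by (metis vector_derivative_at)
qed

text \<open>
  Differentiate the constraint \<open>c\<^sup>T c = 1\<close>.
\<close>

lemma stiefel_velocity_antisymmetric:
  assumes "\<And>s. c s \<in> stiefel" "(c has_vector_derivative v) (at t)"
  shows "transpose (transpose (c t) ** v) = - (transpose (c t) ** v)"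
proof -
  have "((\<lambda>s. transpose (c s) ** c s) has_derivative
      (\<lambda>x. transpose (c t) ** (x *\<^sub>R v) + transpose (x *\<^sub>R v) ** c t)) (at t)"
    using assms(2) unfolding has_vector_derivative_def by (intro matrix_derivative_intros)
  moreover have "(\<lambda>s. transpose (c s) ** c s) = (\<lambda>s. mat 1)"
    using assms(1) by (simp add: stiefel_def)
  ultimately have "((\<lambda>s. mat 1) has_derivative
      (\<lambda>x. transpose (c t) ** (x *\<^sub>R v) + transpose (x *\<^sub>R v) ** c t)) (at t)"
    by simp
  from has_derivative_unique[OF this has_derivative_const]
  have "(\<lambda>x. transpose (c t) ** (x *\<^sub>R v) + transpose (x *\<^sub>R v) ** c t) = (\<lambda>x. 0)" .
  from fun_cong[OF this, of 1] show ?thesis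
    by (simp add: matrix_transpose_mul eq_neg_iff_add_eq_0 add.commute)
qed

context smooth_kohn_sham
begin

text \<open>
  The two gradients differ by \<open>U \<Sigma>\<close> with symmetric \<open>\<Sigma>\<close>, which is orthogonal to every velocity
  of a curve on the Stiefel manifold.
\<close>

lemma grad_E_inner_velocity:
  assumes "transpose (transpose U ** v) = - (transpose U ** v)"
  shows "grad_E K U \<bullet> v = grad_G K U \<bullet> v"
proof -
  have "grad_E K U - grad_G K U = U ** (transpose U ** grad_E K U)"
    by (simp add: grad_G_def proj_def matrix_bilinear_simps matrix_mul_assoc)
  then have "(grad_E K U - grad_G K U) \<bullet> v = (transpose U ** v) \<bullet> (transpose U ** grad_E K U)"
    by (simp add: inner_commute[of _ v] inner_matrix_mult_right)
  also have "\<dots> = 0"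
    by (intro inner_antisymmetric_symmetric assms transpose_multiplier)
  finally show ?thesis by (simp add: inner_diff_left)
qed

lemma grad_G_deriv_inner_tangent:
  assumes "D \<in> tangent_grass U"
  shows "grad_G_deriv K U D \<bullet> D = hess_G2 K U D D"
proof -
  have "transpose U ** D = transpose (transpose D ** U)" by (simp add: matrix_transpose_mul)
  then have "transpose U ** D = 0"
    using assms by (simp add: tangent_grass_def
        linear_0[OF bounded_linear.linear[OF bounded_linear_transpose]])
  then have "D \<bullet> (U ** (transpose D ** grad_E K U)) = 0"
    by (simp add: inner_matrix_mult_right)
  then show ?thesis
    by (simp add: grad_G_deriv_def hess_G2_def inner_diff_right inner_commute[of _ D] matrix_mul_assoc)
qed

lemma linear_grad_G_deriv:
  "density U \<in> \<Omega> \<Longrightarrow> linear (grad_G_deriv K U)"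
  using grad_G_has_derivative has_derivative_linear by blast

lemma linear_hess_G:
  assumes "density U \<in> \<Omega>"
  shows "linear (hess_G K U)"
  using linear_add[OF has_derivative_linear[OF grad_E_has_derivative[OF assms]]]
    linear_scale[OF has_derivative_linear[OF grad_E_has_derivative[OF assms]]]
  by (intro linearI) (simp_all add: hess_G_def proj_def matrix_bilinear_simps algebra_simps)

text \<open>
  The second order expansion of the energy along a retraction, integrated in two stages. The map
  \<open>\<tau> \<mapsto> grad_G K (c \<tau>) \<bullet> D\<close> has derivative \<open>h\<close> at \<open>0\<close>, and the constants \<open>e\<close>, \<open>B\<close> and
  \<open>C * \<theta>\<close> control how far the derivative moves from \<open>h\<close>; this bounds that map from above. The
  derivative of the energy adds to it the pairing of the gradient with \<open>c' \<tau> - D\<close>, which the bound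
  on the second order behaviour of the retraction makes at most \<open>M * C * \<tau> * (norm D)\<^sup>2\<close>.
\<close>

lemma energy_along_retraction_le:
  fixes U D :: "real^'n^'g"
  assumes dens: "density ` (stiefel :: (real^'n^'g) set) \<subseteq> \<Omega>"
    and retr: "retraction_map ortho"
    and U: "U \<in> stiefel" and D: "D \<in> tangent_grass U"
    and t: "0 \<le> t" "t * norm D \<le> \<theta>" and C: "0 \<le> C"
    and vel: "\<And>\<tau>. 0 \<le> \<tau> \<Longrightarrow> norm (vector_derivative (ortho U D) (at \<tau>) - D) \<le> C * \<tau> * (norm D)^2"
    and grad: "\<And>\<tau>. \<lbrakk>0 \<le> \<tau>; \<tau> \<le> t\<rbrakk> \<Longrightarrow> norm (grad_G K (ortho U D \<tau>)) \<le> M"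
    and near: "\<And>\<tau> X. \<lbrakk>0 \<le> \<tau>; \<tau> \<le> t\<rbrakk> \<Longrightarrow>
      norm (grad_G_deriv K (ortho U D \<tau>) X - grad_G_deriv K U X) \<le> e * norm X"
    and bnd: "\<And>X. norm (grad_G_deriv K U X) \<le> B * norm X" and B: "0 \<le> B" and e: "0 \<le> e"
  shows "energy K (ortho U D t) \<le> energy K U + 2 * t * (grad_G K U \<bullet> D)
    + t^2 * (hess_G2 K U D D + (e * (1 + C * \<theta>) + B * (C * \<theta>) + M * C) * (norm D)^2)"
proof -
  define c where "c = ortho U D"
  define v where "v \<tau> = vector_derivative c (at \<tau>)" for \<tau>
  define s h where "s = grad_G K U \<bullet> D" and "h = hess_G2 K U D D"
  define \<kappa>1 where "\<kappa>1 = e * (1 + C * \<theta>) + B * (C * \<theta>)"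
  have Dst: "D \<in> tangent_stiefel U" by (rule tangent_grass_imp_stiefel[OF D])
  have cst: "c \<tau> \<in> stiefel" for \<tau>
    using retr U Dst unfolding retraction_map_def c_def by blast
  have c0: "c 0 = U"
    using retr U Dst unfolding retraction_map_def c_def by blast
  have cv: "(c has_vector_derivative v \<tau>) (at \<tau>)" for \<tau>
    unfolding c_def v_def using retraction_has_vector_derivative[OF retr U Dst] .
  have dc: "density (c \<tau>) \<in> \<Omega>" for \<tau> using dens cst by blast
  have vD: "norm (v \<tau> - D) \<le> C * \<tau> * (norm D)^2" if "0 \<le> \<tau>" for \<tau>
    using vel[OF that] unfolding v_def c_def .
  have M: "0 \<le> M" using grad[of 0] t(1) norm_ge_zero order_trans by blast
  have \<phi>: "((\<lambda>\<tau>. energy K (c \<tau>)) has_real_derivative 2 * (grad_G K (c \<tau>) \<bullet> v \<tau>)) (at \<tau>)" for \<tau>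
  proof -
    have "((\<lambda>\<tau>. energy K (c \<tau>)) has_derivative (\<lambda>x. 2 * (grad_E K (c \<tau>) \<bullet> (x *\<^sub>R v \<tau>)))) (at \<tau>)"
      using cv[of \<tau>] energy_has_derivative[OF dc] unfolding has_vector_derivative_def
      by (rule has_derivative_compose)
    moreover have "grad_E K (c \<tau>) \<bullet> v \<tau> = grad_G K (c \<tau>) \<bullet> v \<tau>"
      by (intro grad_E_inner_velocity stiefel_velocity_antisymmetric[OF cst cv])
    moreover have "(*) (2 * (grad_G K (c \<tau>) \<bullet> v \<tau>)) = (\<lambda>x. 2 * (x * (grad_G K (c \<tau>) \<bullet> v \<tau>)))"
      by (simp add: fun_eq_iff)
    ultimately show ?thesis
      by (simp add: has_field_derivative_def)
  qed
  have \<psi>: "((\<lambda>\<tau>. grad_G K (c \<tau>) \<bullet> D) has_real_derivative grad_G_deriv K (c \<tau>) (v \<tau>) \<bullet> D) (at \<tau>)" for \<tau>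
  proof -
    have "((\<lambda>\<tau>. grad_G K (c \<tau>)) has_derivative (\<lambda>x. grad_G_deriv K (c \<tau>) (x *\<^sub>R v \<tau>))) (at \<tau>)"
      using cv[of \<tau>] grad_G_has_derivative[OF dc] unfolding has_vector_derivative_def
      by (rule has_derivative_compose)
    from has_derivative_inner_left[OF this, of D]
    have "((\<lambda>\<tau>. grad_G K (c \<tau>) \<bullet> D) has_derivative
        (\<lambda>x. grad_G_deriv K (c \<tau>) (x *\<^sub>R v \<tau>) \<bullet> D)) (at \<tau>)" .
    moreover have "(\<lambda>x. grad_G_deriv K (c \<tau>) (x *\<^sub>R v \<tau>) \<bullet> D)
        = (*) (grad_G_deriv K (c \<tau>) (v \<tau>) \<bullet> D)"
      by (simp add: fun_eq_iff linear_scale[OF linear_grad_G_deriv[OF dc]])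
    ultimately show ?thesis
      by (simp add: has_field_derivative_def)
  qed
  have \<tau>D: "C * \<tau> * (norm D)^2 \<le> C * \<theta> * norm D" if "0 \<le> \<tau>" "\<tau> \<le> t" for \<tau>
  proof -
    have "\<tau> * norm D \<le> \<theta>" using that t mult_right_mono[OF that(2), of "norm D"] by simp
    then have "(C * norm D) * (\<tau> * norm D) \<le> (C * norm D) * \<theta>"
      using C by (intro mult_left_mono) auto
    then show ?thesis by (simp add: power2_eq_square algebra_simps)
  qed
  have \<psi>': "grad_G_deriv K (c \<tau>) (v \<tau>) \<bullet> D \<le> h + \<kappa>1 * (norm D)^2" if \<tau>: "0 \<le> \<tau>" "\<tau> \<le> t" for \<tau>
  proof -
    have dif: "norm (v \<tau> - D) \<le> C * \<theta> * norm D"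
      using vD[OF \<tau>(1)] \<tau>D[OF \<tau>] by linarith
    have "norm (v \<tau>) \<le> norm D + norm (v \<tau> - D)"
      by (metis add.commute diff_add_cancel norm_triangle_ineq)
    then have nv: "norm (v \<tau>) \<le> (1 + C * \<theta>) * norm D"
      using dif by (simp add: algebra_simps)
    \<comment> \<open>?R collects the two errors: base point c \<tau> instead of U, velocity v \<tau> instead of D.\<close>
    let ?R = "(grad_G_deriv K (c \<tau>) (v \<tau>) - grad_G_deriv K U (v \<tau>)) + grad_G_deriv K U (v \<tau> - D)"
    have "norm ?R \<le> e * norm (v \<tau>) + B * norm (v \<tau> - D)"
      using near[OF \<tau>, of "v \<tau>"] bnd[of "v \<tau> - D"] unfolding c_def
      by (intro norm_triangle_le add_mono)
    also have "\<dots> \<le> e * ((1 + C * \<theta>) * norm D) + B * (C * \<theta> * norm D)"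
      using nv dif e B by (intro add_mono mult_left_mono)
    also have "\<dots> = \<kappa>1 * norm D" by (simp add: \<kappa>1_def algebra_simps)
    finally have R: "norm ?R \<le> \<kappa>1 * norm D" .
    have "grad_G_deriv K (c \<tau>) (v \<tau>) = grad_G_deriv K U D + ?R"
      using dens U by (simp add: linear_diff[OF linear_grad_G_deriv] image_subset_iff)
    then have "grad_G_deriv K (c \<tau>) (v \<tau>) \<bullet> D = (grad_G_deriv K U D + ?R) \<bullet> D"
      by (rule arg_cong)
    also have "\<dots> = h + ?R \<bullet> D"
      by (simp only: inner_add_left grad_G_deriv_inner_tangent[OF D] h_def)
    finally have "grad_G_deriv K (c \<tau>) (v \<tau>) \<bullet> D = h + ?R \<bullet> D" .
    moreover have "?R \<bullet> D \<le> \<kappa>1 * norm D * norm D"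
      using norm_cauchy_schwarz[of ?R D] mult_right_mono[OF R, of "norm D"] by simp
    ultimately show ?thesis by (simp add: power2_eq_square)
  qed
  have \<psi>_le: "grad_G K (c \<tau>) \<bullet> D \<le> s + \<tau> * (h + \<kappa>1 * (norm D)^2)" if \<tau>: "0 \<le> \<tau>" "\<tau> \<le> t" for \<tau>
  proof -
    have "grad_G K (c \<tau>) \<bullet> D - \<tau> * (h + \<kappa>1 * (norm D)^2) \<le> grad_G K (c 0) \<bullet> D - 0 * (h + \<kappa>1 * (norm D)^2)"
      using \<tau>(1)
    proof (rule DERIV_nonpos_imp_nonincreasing)
      fix x assume "0 \<le> x" "x \<le> \<tau>"
      then show "\<exists>y. ((\<lambda>\<tau>. grad_G K (c \<tau>) \<bullet> D - \<tau> * (h + \<kappa>1 * (norm D)^2)) has_real_derivative y) (at x) \<and> y \<le> 0"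
        using \<psi>'[of x] \<tau>
        by (intro exI[of _ "grad_G_deriv K (c x) (v x) \<bullet> D - (h + \<kappa>1 * (norm D)^2)"] conjI)
          (auto intro!: derivative_eq_intros \<psi>)
    qed
    then show ?thesis by (simp add: c0 s_def)
  qed
  let ?q = "h + (\<kappa>1 + M * C) * (norm D)^2"
  have "energy K (c t) - (2 * t * s + t^2 * ?q) \<le> energy K (c 0) - (2 * 0 * s + 0^2 * ?q)"
    using t(1)
  proof (rule DERIV_nonpos_imp_nonincreasing)
    fix x assume x: "0 \<le> x" "x \<le> t"
    have "grad_G K (c x) \<bullet> (v x - D) \<le> norm (grad_G K (c x)) * norm (v x - D)"
      by (rule norm_cauchy_schwarz)
    also have "\<dots> \<le> M * (C * x * (norm D)^2)"
      using grad[OF x] vD[OF x(1)] M by (intro mult_mono) (auto simp: c_def)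
    finally have "grad_G K (c x) \<bullet> v x \<le> s + x * (h + \<kappa>1 * (norm D)^2) + M * (C * x * (norm D)^2)"
      using \<psi>_le[OF x] by (simp add: inner_diff_right)
    then have "2 * (grad_G K (c x) \<bullet> v x) - (2 * s + 2 * x * ?q) \<le> 0"
      by (simp add: algebra_simps)
    then show "\<exists>y. ((\<lambda>\<tau>. energy K (c \<tau>) - (2 * \<tau> * s + \<tau>^2 * ?q)) has_real_derivative y) (at x) \<and> y \<le> 0"
      by (intro exI[of _ "2 * (grad_G K (c x) \<bullet> v x) - (2 * s + 2 * x * ?q)"] conjI)
        (auto intro!: derivative_eq_intros \<phi>)
  qed
  then show ?thesis
    unfolding c0 by (simp add: s_def h_def \<kappa>1_def c_def algebra_simps)
qed

end

section \<open>One step of the method\<close>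

text \<open>
  For \<open>t \<le> - s / h\<close> the quadratic model attains at least half of its linear part, so that
  \<open>\<zeta> t \<ge> 1/2 > \<eta>\<close> and the first choice of \<open>t\<close> is accepted. As \<open>- s / h \<ge> 1/2\<close>, the maximum with
  \<open>1/100\<close> is \<open>- s / h\<close>.
\<close>

lemma adaptive_step_newton:
  fixes K :: "'g::finite kohn_sham" and U D :: "real^'n^'g"
  defines "s \<equiv> grad_G K U \<bullet> D" and "h \<equiv> hess_G2 K U D D"
  assumes "0 < h" "s \<le> - h / 2" "\<eta> < 1/2" "D \<noteq> 0" "0 < \<theta>"
  shows "adaptive_step K U D (- s / h) (1/100) \<eta> \<theta> = min (- s / h) (\<theta> / norm D)"
proof -
  define t where "t = min (- s / h) (\<theta> / norm D)"
  have s: "s < 0" using assms by simp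
  have "1/2 \<le> - s / h" using assms by (simp add: field_simps)
  then have "max (- s / h) (1/100) = - s / h" by (intro max_absorb1) linarith
  then have t': "min (max (- s / h) (1/100)) (\<theta> / norm D) = t" by (simp only: t_def)
  have "t \<le> - s / h" by (simp add: t_def)
  then have "t * h \<le> - s" using \<open>0 < h\<close> by (simp add: field_simps)
  then have "1/2 \<le> (s + t / 2 * h) / s" using s by (simp add: field_simps)
  then have "\<not> (s + t / 2 * h) / s < \<eta>" using \<open>\<eta> < 1/2\<close> by linarith
  then show ?thesis
    using t' unfolding adaptive_step_def Let_def t_def[symmetric] s_def[symmetric] h_def[symmetric]
    by simp
qed

text \<open>
  The bound on the gradient by the direction converts the residual, which is relative to the
  gradient, into one relative to the direction; coercivity then absorbs it into the curvature.
\<close>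

lemma inexact_newton_direction:
  assumes \<Lambda>: "\<Lambda> > 0" "norm (hess_G K U D) \<le> \<Lambda> * norm D"
    and \<sigma>: "0 < \<sigma>" "\<sigma> \<le> 1/2" "\<sigma> \<le> \<nu> / (4 * \<Lambda>)"
    and coercive: "\<nu> * (norm D)^2 \<le> hess_G2 K U D D"
    and residual: "norm (hess_G K U D + grad_G K U) \<le> \<sigma> * norm (grad_G K U)"
  shows "norm (grad_G K U) \<le> 2 * \<Lambda> * norm D"
    and "\<bar>grad_G K U \<bullet> D + hess_G2 K U D D\<bar> \<le> hess_G2 K U D D / 2"
proof -
  let ?g = "grad_G K U" and ?r = "hess_G K U D + grad_G K U"
  have "norm ?g \<le> norm ?r + norm (hess_G K U D)"
    using norm_triangle_ineq4[of ?r "hess_G K U D"] by simp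
  moreover have "\<sigma> * norm ?g \<le> 1/2 * norm ?g" using \<sigma> by (intro mult_right_mono) auto
  ultimately show g: "norm ?g \<le> 2 * \<Lambda> * norm D"
    using residual \<Lambda>(2) by linarith
  have "norm ?r \<le> \<nu> / (4 * \<Lambda>) * (2 * \<Lambda> * norm D)"
    using residual mult_mono[OF \<sigma>(3) g] \<sigma>(1,3) by force
  also have "\<dots> = \<nu> / 2 * norm D" using \<Lambda>(1) by simp
  finally have "norm ?r * norm D \<le> \<nu> / 2 * norm D * norm D" by (intro mult_right_mono) auto
  then have "\<bar>?r \<bullet> D\<bar> \<le> hess_G2 K U D D / 2"
    using Cauchy_Schwarz_ineq2[of ?r D] coercive by (simp add: power2_eq_square)
  then show "\<bar>?g \<bullet> D + hess_G2 K U D D\<bar> \<le> hess_G2 K U D D / 2"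
    by (simp add: hess_G2_def inner_add_left add.commute)
qed

text \<open>
  The central estimate. The constants do not depend on the iterate, thanks to compactness of
  the Stiefel manifold. The parameter \<open>\<rho>\<close> limits the length of a step; the alternative for \<open>t\<close> says that only the truncation makes a step short, which later
  forces the directions themselves to tend to zero.
\<close>

lemma (in smooth_kohn_sham) newton_step_decrease:
  assumes dens: "density ` (stiefel :: (real^'n^'g) set) \<subseteq> \<Omega>"
    and retr: "retraction_map ortho" and C: "0 < C"
    and pos: "\<And>U D t. \<lbrakk>U \<in> stiefel; D \<in> tangent_grass U; 0 \<le> t\<rbrakk> \<Longrightarrow>
      norm (ortho U D t - U) \<le> C * t * norm D"
    and vel: "\<And>U D t. \<lbrakk>U \<in> stiefel; D \<in> tangent_grass U; 0 \<le> t\<rbrakk> \<Longrightarrow>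
      norm (vector_derivative (ortho U D) (at t) - D) \<le> C * t * (norm D)^2"
    and \<nu>: "0 < \<nu>" and \<rho>: "0 < \<rho>" and \<eta>: "\<eta> < 1/2"
  obtains \<sigma> \<theta> \<Lambda> :: real where "0 < \<sigma>" "\<sigma> < 1" "0 < \<theta>" "\<theta> < 1" "C * \<theta> \<le> \<rho>" "0 < \<Lambda>"
    "\<And>(U :: real^'n^'g) D t. \<lbrakk>U \<in> stiefel; D \<in> tangent_grass U; grad_G K U \<noteq> 0;
       \<nu> * (norm D)^2 \<le> hess_G2 K U D D;
       norm (hess_G K U D + grad_G K U) \<le> \<sigma> * norm (grad_G K U);
       t = adaptive_step K U D (- (grad_G K U \<bullet> D) / hess_G2 K U D D) (1/100) \<eta> \<theta>\<rbrakk>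
     \<Longrightarrow> norm (grad_G K U) \<le> 2 * \<Lambda> * norm D \<and> 0 < t \<and> t * norm D \<le> \<theta>
       \<and> (t * norm D = \<theta> \<or> 1/2 \<le> t)
       \<and> energy K (ortho U D t) \<le> energy K U - \<nu> / 4 * t * (norm D)^2"
proof -
  let ?S = "stiefel :: (real^'n^'g) set"
  have dS: "density U \<in> \<Omega>" if "U \<in> ?S" for U using dens that by blast
  obtain \<Lambda>1 where \<Lambda>1: "\<Lambda>1 > 0" "\<And>U X. U \<in> ?S \<Longrightarrow> norm (hess_G K U X) \<le> \<Lambda>1 * norm X"
    using compact_linear_family_bounded[OF compact_stiefel continuous_on_hess_G[OF dens]
        linear_hess_G[OF dS]] by blast
  obtain \<Lambda>2 where \<Lambda>2: "\<Lambda>2 > 0" "\<And>U X. U \<in> ?S \<Longrightarrow> norm (grad_G_deriv K U X) \<le> \<Lambda>2 * norm X"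
    using compact_linear_family_bounded[OF compact_stiefel continuous_on_grad_G_deriv[OF dens]
        linear_grad_G_deriv[OF dS]] by blast
  define \<Lambda> where "\<Lambda> = max \<Lambda>1 \<Lambda>2"
  have \<Lambda>: "\<Lambda> > 0" using \<Lambda>1(1) by (simp add: \<Lambda>_def)
  have hb: "norm (hess_G K U X) \<le> \<Lambda> * norm X"
    and gb: "norm (grad_G_deriv K U X) \<le> \<Lambda> * norm X" if "U \<in> ?S" for U X
    using \<Lambda>1(2)[OF that, of X] \<Lambda>2(2)[OF that, of X]
      mult_right_mono[of \<Lambda>1 \<Lambda> "norm X"] mult_right_mono[of \<Lambda>2 \<Lambda> "norm X"]
    unfolding \<Lambda>_def by auto
  \<comment> \<open>e is the tolerance for the variation of the gradient and of its derivative along a step;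
      its value makes the error t * \<kappa> below at most \<nu> / 4 together with the bound on \<theta>.\<close>
  define e where "e = \<nu> / (8 * (3 + 2 * C))"
  have e: "e > 0" "e * (3 + 2 * C) = \<nu> / 8" using \<nu> C by (auto simp: e_def field_simps)
  obtain d1 where d1: "d1 > 0" "\<And>U V X. \<lbrakk>U \<in> ?S; V \<in> ?S; dist U V < d1\<rbrakk>
      \<Longrightarrow> norm (grad_G_deriv K U X - grad_G_deriv K V X) \<le> e * norm X"
    using compact_linear_family_uniformly_continuous[OF compact_stiefel
        continuous_on_grad_G_deriv[OF dens] linear_grad_G_deriv[OF dS] e(1)] by blast
  have "uniformly_continuous_on ?S (grad_G K)"
    using compact_uniformly_continuous continuous_on_grad_G[OF dens] compact_stiefel by blast
  then obtain d2 where d2: "d2 > 0"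
    "\<And>U V. \<lbrakk>U \<in> ?S; V \<in> ?S; dist V U < d2\<rbrakk> \<Longrightarrow> dist (grad_G K V) (grad_G K U) < e"
    using e(1) unfolding uniformly_continuous_on_def by metis
  \<comment> \<open>m is the radius in which all uniform estimates hold; \<theta> keeps the whole step within it.\<close>
  define m where "m = Min {1, d1, d2, \<rho>, \<nu> / (32 * \<Lambda>)}"
  have m: "0 < m" "m \<le> 1" "m \<le> d1" "m \<le> d2" "m \<le> \<rho>" "m \<le> \<nu> / (32 * \<Lambda>)"
    using d1(1) d2(1) \<rho> \<nu> \<Lambda> by (auto simp: m_def)
  define \<theta> where "\<theta> = min (1/2) (m / (2 * C))"
  have \<theta>: "0 < \<theta>" "\<theta> < 1" using m C by (auto simp: \<theta>_def)
  have "\<theta> \<le> m / (2 * C)" by (simp add: \<theta>_def)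
  then have "C * \<theta> \<le> m / 2" using C by (simp add: field_simps)
  then have C\<theta>: "C * \<theta> < m" using m by linarith
  have \<Lambda>C\<theta>: "4 * \<Lambda> * (C * \<theta>) \<le> \<nu> / 8"
  proof -
    have "C * \<theta> \<le> \<nu> / (32 * \<Lambda>)" using C\<theta> m by linarith
    then show ?thesis using \<Lambda> by (simp add: field_simps)
  qed
  define \<sigma> where "\<sigma> = min (1/2) (\<nu> / (4 * \<Lambda>))"
  have \<sigma>: "0 < \<sigma>" "\<sigma> \<le> 1/2" "\<sigma> \<le> \<nu> / (4 * \<Lambda>)" using \<nu> \<Lambda> by (auto simp: \<sigma>_def)
  show ?thesis
  proof (rule that)
    show "0 < \<sigma>" "\<sigma> < 1" "0 < \<theta>" "\<theta> < 1" "C * \<theta> \<le> \<rho>" "0 < \<Lambda>"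
      using \<sigma> \<theta> \<Lambda> C\<theta> m by auto
  next
    fix U D :: "real^'n^'g" and t
    assume U: "U \<in> stiefel" and D: "D \<in> tangent_grass U" and g0: "grad_G K U \<noteq> 0"
      and coercive: "\<nu> * (norm D)^2 \<le> hess_G2 K U D D"
      and residual: "norm (hess_G K U D + grad_G K U) \<le> \<sigma> * norm (grad_G K U)"
      and t_def: "t = adaptive_step K U D (- (grad_G K U \<bullet> D) / hess_G2 K U D D) (1/100) \<eta> \<theta>"
    define s h where "s = grad_G K U \<bullet> D" and "h = hess_G2 K U D D"
    have g: "norm (grad_G K U) \<le> 2 * \<Lambda> * norm D" and sh: "\<bar>s + h\<bar> \<le> h / 2"
      using inexact_newton_direction[OF \<Lambda> hb[OF U] \<sigma> coercive residual] unfolding s_def h_def .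
    have D0: "D \<noteq> 0" using g g0 by auto
    then have nD: "norm D > 0" by simp
    have h: "\<nu> * (norm D)^2 \<le> h" using coercive by (simp add: h_def)
    moreover have "0 < \<nu> * (norm D)^2" using \<nu> D0 by simp
    ultimately have h0: "0 < h" by linarith
    have s: "s \<le> - h / 2" "- (3/2) * h \<le> s" using sh by linarith+
    have t: "t = min (- s / h) (\<theta> / norm D)"
      unfolding t_def s_def h_def
      by (rule adaptive_step_newton) (use h0 s \<eta> D0 \<theta> in \<open>auto simp: s_def h_def\<close>)
    have newton: "1/2 \<le> - s / h" "- s / h \<le> 3/2" using s h0 by (simp_all add: field_simps)
    have "0 < - s / h" "0 < \<theta> / norm D" using newton \<theta> nD by (linarith, simp)
    then have t0: "0 < t" by (simp only: t min_less_iff_conj)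
    have t32: "t \<le> 3/2" using newton(2) unfolding t by linarith
    have tD: "t * norm D \<le> \<theta>"
    proof -
      have "t \<le> \<theta> / norm D" by (simp add: t)
      then show ?thesis using nD by (simp add: field_simps)
    qed
    have alt: "t * norm D = \<theta> \<or> 1/2 \<le> t"
      using newton nD by (auto simp: t min_def)
    have th: "t * h \<le> - s"
    proof -
      have "t \<le> - s / h" by (simp add: t)
      then show ?thesis using h0 by (simp add: field_simps)
    qed
    have on: "ortho U D \<tau> \<in> ?S" for \<tau>
      using retr U tangent_grass_imp_stiefel[OF D] unfolding retraction_map_def by blast
    have close: "norm (ortho U D \<tau> - U) < m" if "0 \<le> \<tau>" "\<tau> \<le> t" for \<tau>
    proof -
      have "\<tau> * norm D \<le> \<theta>" using mult_right_mono[OF that(2), of "norm D"] tD by simp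
      then have "C * (\<tau> * norm D) \<le> C * \<theta>" using C by (intro mult_left_mono) auto
      then show ?thesis using pos[OF U D that(1)] C\<theta> by (simp add: mult.assoc)
    qed
    have grad: "norm (grad_G K (ortho U D \<tau>)) \<le> norm (grad_G K U) + e" if "0 \<le> \<tau>" "\<tau> \<le> t" for \<tau>
    proof -
      have "dist (grad_G K (ortho U D \<tau>)) (grad_G K U) < e"
        using close[OF that] m by (intro d2(2) U on) (simp add: dist_norm)
      then show ?thesis
        using norm_triangle_sub[of "grad_G K (ortho U D \<tau>)" "grad_G K U"] by (simp add: dist_norm)
    qed
    have near: "norm (grad_G_deriv K (ortho U D \<tau>) X - grad_G_deriv K U X) \<le> e * norm X"
      if "0 \<le> \<tau>" "\<tau> \<le> t" for \<tau> X
      using close[OF that] m by (intro d1(2) U on) (simp add: dist_norm)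
    define \<kappa> where "\<kappa> = e * (1 + C * \<theta>) + \<Lambda> * (C * \<theta>) + (norm (grad_G K U) + e) * C"
    have E: "energy K (ortho U D t) \<le> energy K U + 2 * t * s + t^2 * (h + \<kappa> * (norm D)^2)"
      unfolding s_def h_def \<kappa>_def
      using t0 C \<Lambda> e
      by (intro energy_along_retraction_le dens retr U D tD vel grad near gb) auto
    have "t * \<kappa> \<le> \<nu> / 4"
    proof -
      \<comment> \<open>The gradient need not be small, but its product with the step size is, by truncation.\<close>
      have "t * norm (grad_G K U) \<le> t * (2 * \<Lambda> * norm D)"
        using g t0 by (intro mult_left_mono) auto
      also have "\<dots> \<le> 2 * \<Lambda> * \<theta>"
        using mult_left_mono[OF tD, of "2 * \<Lambda>"] \<Lambda> by (simp add: algebra_simps)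
      finally have 1: "t * norm (grad_G K U) * C \<le> 2 * \<Lambda> * \<theta> * C"
        using C by (intro mult_right_mono) auto
      let ?w = "e * (1 + C * \<theta>) + \<Lambda> * (C * \<theta>) + e * C"
      have "e * (C * \<theta>) \<le> e * 1" using C\<theta> m e by (intro mult_left_mono) auto
      then have w: "?w \<le> 2 * e + \<Lambda> * (C * \<theta>) + e * C" by (simp add: algebra_simps)
      have "t * ?w \<le> 3/2 * ?w"
        using t32 e C \<theta> \<Lambda> by (intro mult_right_mono) auto
      also have "\<dots> \<le> e * (3 + 2 * C) + 2 * \<Lambda> * (C * \<theta>)"
      proof -
        have "0 \<le> \<Lambda> * (C * \<theta>)" "0 \<le> e * C" using e C \<theta> \<Lambda> by auto
        then show ?thesis using w by (simp add: algebra_simps)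
      qed
      finally have 2: "t * ?w \<le> \<nu> / 8 + 2 * \<Lambda> * (C * \<theta>)" using e(2) by simp
      have "t * \<kappa> = t * ?w + t * norm (grad_G K U) * C"
        by (simp add: \<kappa>_def algebra_simps)
      moreover have "2 * \<Lambda> * \<theta> * C = 2 * \<Lambda> * (C * \<theta>)" by simp
      ultimately show ?thesis using 1 2 \<Lambda>C\<theta> by linarith
    qed
    then have "t * \<kappa> * (t * (norm D)^2) \<le> \<nu> / 4 * (t * (norm D)^2)"
      using t0 by (intro mult_right_mono) auto
    \<comment> \<open>t * h \<le> - s leaves at least half of the linear decrease.\<close>
    moreover have "t * (2 * s + t * h) \<le> t * (- \<nu> / 2 * (norm D)^2)"
      using t0 th s h by (intro mult_left_mono) auto
    moreover have "2 * t * s + t^2 * (h + \<kappa> * (norm D)^2)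
        = t * (2 * s + t * h) + t * \<kappa> * (t * (norm D)^2)"
      by (simp add: power2_eq_square algebra_simps)
    ultimately have "energy K (ortho U D t) \<le> energy K U - \<nu> / 4 * t * (norm D)^2"
      using E by (simp add: algebra_simps)
    then show "norm (grad_G K U) \<le> 2 * \<Lambda> * norm D \<and> 0 < t \<and> t * norm D \<le> \<theta>
       \<and> (t * norm D = \<theta> \<or> 1/2 \<le> t)
       \<and> energy K (ortho U D t) \<le> energy K U - \<nu> / 4 * t * (norm D)^2"
      using g t0 tD alt by blast
  qed
qed

section \<open>Convergence\<close>

lemma decreasing_bounded_below_increments_tendsto_0:
  fixes f a :: "nat \<Rightarrow> real"
  assumes "\<And>n. 0 \<le> a n" "\<And>n. f (Suc n) \<le> f n - a n" "\<And>n. b \<le> f n"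
  shows "a \<longlonglongrightarrow> 0"
proof -
  have "decseq f"
    by (rule decseq_SucI) (use assms(1,2) in \<open>smt (verit)\<close>)
  then obtain l where "f \<longlonglongrightarrow> l"
    using decseq_convergent[of f b] assms(3) by blast
  then have "(\<lambda>n. f n - f (Suc n)) \<longlonglongrightarrow> 0"
    using tendsto_diff[OF _ LIMSEQ_Suc] by fastforce
  moreover have "\<forall>\<^sub>F n in sequentially. 0 \<le> a n" "\<forall>\<^sub>F n in sequentially. a n \<le> f n - f (Suc n)"
    using assms(1,2) by (auto simp: algebra_simps)
  ultimately show ?thesis using real_tendsto_sandwich[of "\<lambda>_. 0" a] by simp
qed

theorem theorem4p4:
  fixes K :: "'g::finite kohn_sham"
    and ortho :: "real^'n^'g \<Rightarrow> real^'n^'g \<Rightarrow> real \<Rightarrow> real^'n^'g"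
    and Ustar U0 :: "real^'n^'g"
    and \<Omega> :: "(real^'g) set"
    and L0 L1 C0 C1 \<delta>1 \<delta>2 \<nu>1 E0 \<gamma>1 \<gamma>2 q \<eta> :: real
  assumes lap_symmetric: "transpose (lap K) = lap K"
    and v_ext_symmetric: "transpose (v_ext K) = v_ext K"
    and lap_dag: "is_generalized_inverse (lap K) (lap_dag K)"
    and smooth_enough: "open \<Omega>" "density ` (stiefel :: (real^'n^'g) set) \<subseteq> \<Omega>"
      "C_k_on 2 \<Omega> (xc_energy K)"
    and L0_pos: "L0 > 0"
    and lipschitz: "\<And>U V :: real^'n^'g. U \<in> stiefel \<Longrightarrow> V \<in> stiefel \<Longrightarrow>
      norm (grad_E K U - grad_E K V) \<le> L0 * norm (U - V)"
    and minimizer: "local_minimizer K Ustar"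
    and \<delta>1_pos: "\<delta>1 > 0" and \<nu>1_pos: "\<nu>1 > 0"
    and coercive: "\<And>U D. U \<in> stiefel \<Longrightarrow> grass_class U \<in> grass_ball Ustar \<delta>1 \<Longrightarrow>
      D \<in> tangent_grass U \<Longrightarrow> hess_G2 K U D D \<ge> \<nu>1 * (norm D)^2"
    and retraction: "retraction_map ortho"
    and C1_pos: "C1 > 0"
    and ortho_bound: "\<And>U D t. U \<in> stiefel \<Longrightarrow> D \<in> tangent_grass U \<Longrightarrow> t \<ge> 0 \<Longrightarrow>
      norm (ortho U D t - U) \<le> C1 * t * norm D"
    and ortho_deriv_bound: "\<And>U D t. U \<in> stiefel \<Longrightarrow> D \<in> tangent_grass U \<Longrightarrow> t \<ge> 0 \<Longrightarrow>
      norm (vector_derivative (\<lambda>s. ortho U D s) (at t) - D) \<le> C1 * t * (norm D)^2"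
    and C0_pos: "C0 > 0"
    and C0_bound: "\<And>\<Psi> :: real^'n^'g. \<Psi> \<in> stiefel \<Longrightarrow> norm (grad_E K \<Psi>) \<le> C0"
    and L1_eq: "L1 = L0 + 2 * C0"
    and \<delta>2_range: "0 < \<delta>2" "\<delta>2 < \<delta>1 / (1 + 3 * C1 / \<nu>1 * L1)"
    and E0_gt: "E0 > energy K Ustar"
    and level_subset: "level_set K E0 \<inter> grass_ball Ustar \<delta>1 \<subseteq> grass_ball Ustar \<delta>2"
    and parameters: "0 < \<gamma>1" "\<gamma>1 < 1" "0 < \<gamma>2" "\<gamma>2 < 1" "0 < q" "q < 1" "0 < \<eta>" "\<eta> < 1/2"
    and U0: "U0 \<in> stiefel" "grass_class U0 \<in> grass_ball Ustar \<delta>2 \<inter> level_set K E0"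
  shows "\<exists>\<sigma> \<theta> :: nat \<Rightarrow> real.
    (\<forall>n. 0 < \<sigma> n \<and> \<sigma> n < 1 \<and> 0 < \<theta> n \<and> \<theta> n < 1) \<and>
    (\<forall>U. newton_sequence K ortho 0 \<gamma>1 \<gamma>2 q \<eta> \<sigma> \<theta> U0 U \<longrightarrow>
       (\<exists>n>0. norm (grad_G K (U n)) = 0) \<or>
       (\<lambda>n. norm (grad_G K (U n))) \<longlonglongrightarrow> 0)"
proof -
  interpret smooth_kohn_sham K \<Omega>
    by unfold_locales (fact lap_symmetric v_ext_symmetric smooth_enough
        generalized_inverse_symmetric[OF lap_dag lap_symmetric])+
  have \<delta>21: "\<delta>2 < \<delta>1"
  proof -
    have "0 \<le> 3 * C1 / \<nu>1 * L1" using C1_pos \<nu>1_pos L1_eq L0_pos C0_pos by simp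
    then have "\<delta>1 / (1 + 3 * C1 / \<nu>1 * L1) \<le> \<delta>1"
      using \<delta>1_pos by (simp add: divide_le_eq mult_left_mono)
    then show ?thesis using \<delta>2_range by linarith
  qed
  obtain \<sigma> \<theta> \<Lambda> where par: "0 < \<sigma>" "\<sigma> < 1" "0 < \<theta>" "\<theta> < 1" "C1 * \<theta> \<le> \<delta>1 - \<delta>2" "0 < \<Lambda>"
    and step: "\<And>(U :: real^'n^'g) D t. \<lbrakk>U \<in> stiefel; D \<in> tangent_grass U; grad_G K U \<noteq> 0;
       \<nu>1 * (norm D)^2 \<le> hess_G2 K U D D;
       norm (hess_G K U D + grad_G K U) \<le> \<sigma> * norm (grad_G K U);
       t = adaptive_step K U D (- (grad_G K U \<bullet> D) / hess_G2 K U D D) (1/100) \<eta> \<theta>\<rbrakk>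
     \<Longrightarrow> norm (grad_G K U) \<le> 2 * \<Lambda> * norm D \<and> 0 < t \<and> t * norm D \<le> \<theta>
       \<and> (t * norm D = \<theta> \<or> 1/2 \<le> t)
       \<and> energy K (ortho U D t) \<le> energy K U - \<nu>1 / 4 * t * (norm D)^2"
  proof (rule newton_step_decrease[OF smooth_enough(2) retraction C1_pos _ _ \<nu>1_pos _ parameters(8)])
    show "0 < \<delta>1 - \<delta>2" using \<delta>21 by simp
  qed (rule ortho_bound ortho_deriv_bound that; assumption)+
  have main: "(\<lambda>n. norm (grad_G K (U n))) \<longlonglongrightarrow> 0"
    if seq: "newton_sequence K ortho 0 \<gamma>1 \<gamma>2 q \<eta> (\<lambda>_. \<sigma>) (\<lambda>_. \<theta>) U0 U"
      and nonzero: "\<And>n. grad_G K (U n) \<noteq> 0" for U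
  proof -
    define \<tau> where "\<tau> n D = adaptive_step K (U n) D
        (- (grad_G K (U n) \<bullet> D) / hess_G2 K (U n) D D) (1/100) \<eta> \<theta>" for n D
    have "\<exists>D. D \<in> tangent_grass (U n) \<and> U (Suc n) = ortho (U n) D (\<tau> n D)
        \<and> norm (hess_G K (U n) D + grad_G K (U n)) \<le> \<sigma> * norm (grad_G K (U n))" for n
      using conjunct2[OF seq[unfolded newton_sequence_def], THEN spec, of n] nonzero[of n]
      by (simp only: \<tau>_def zero_less_norm_iff not_False_eq_True if_True) blast
    then have "\<exists>D. \<forall>n. D n \<in> tangent_grass (U n) \<and> U (Suc n) = ortho (U n) (D n) (\<tau> n (D n))
        \<and> norm (hess_G K (U n) (D n) + grad_G K (U n)) \<le> \<sigma> * norm (grad_G K (U n))"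
      by (intro choice allI)
    then obtain D where D: "\<forall>n. D n \<in> tangent_grass (U n) \<and> U (Suc n) = ortho (U n) (D n) (\<tau> n (D n))
        \<and> norm (hess_G K (U n) (D n) + grad_G K (U n)) \<le> \<sigma> * norm (grad_G K (U n))"
      by (rule exE)
    define t where "t n = \<tau> n (D n)" for n
    have Dt: "D n \<in> tangent_grass (U n)" "U (Suc n) = ortho (U n) (D n) (t n)"
      "norm (hess_G K (U n) (D n) + grad_G K (U n)) \<le> \<sigma> * norm (grad_G K (U n))"
      "t n = adaptive_step K (U n) (D n)
          (- (grad_G K (U n) \<bullet> D n) / hess_G2 K (U n) (D n) (D n)) (1/100) \<eta> \<theta>" for n
      using spec[OF D, of n] unfolding t_def \<tau>_def by blast+
    have ball_mono: "grass_ball Ustar \<delta>2 \<subseteq> grass_ball Ustar \<delta>1"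
      using \<delta>21 unfolding grass_ball_def by force
    have step': "norm (grad_G K (U n)) \<le> 2 * \<Lambda> * norm (D n) \<and> 0 < t n \<and> t n * norm (D n) \<le> \<theta>
       \<and> (t n * norm (D n) = \<theta> \<or> 1/2 \<le> t n)
       \<and> energy K (U (Suc n)) \<le> energy K (U n) - \<nu>1 / 4 * t n * (norm (D n))^2"
      if "U n \<in> stiefel" "grass_class (U n) \<in> grass_ball Ustar \<delta>2" for n
    proof -
      have "grass_class (U n) \<in> grass_ball Ustar \<delta>1" using ball_mono that(2) by blast
      from step[OF that(1) Dt(1) nonzero coercive[OF that(1) this Dt(1)] Dt(3) Dt(4)]
      show ?thesis unfolding Dt(2)[of n] .
    qed
    have inv: "U n \<in> stiefel \<and> grass_class (U n) \<in> grass_ball Ustar \<delta>2 \<and> energy K (U n) \<le> E0" for n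
    proof (induction n)
      case 0
      have "U 0 = U0" using seq unfolding newton_sequence_def by blast
      then show ?case using U0 mem_level_set_iff by auto
    next
      case (Suc n)
      note s = step'[of n]
      have on: "U (Suc n) \<in> stiefel"
        using retraction Suc tangent_grass_imp_stiefel[OF Dt(1)] Dt(2)
        unfolding retraction_map_def by auto
      have "norm (U (Suc n) - U n) \<le> C1 * t n * norm (D n)"
        unfolding Dt(2) using Suc s by (intro ortho_bound Dt(1)) auto
      also have "\<dots> \<le> C1 * \<theta>"
        using s Suc C1_pos by (simp add: mult.assoc)
      \<comment> \<open>The step stays in the larger ball; the level set condition then returns it to the smaller one.\<close>
      finally have "grass_class (U (Suc n)) \<in> grass_ball Ustar (\<delta>2 + (\<delta>1 - \<delta>2))"
        using par(5) Suc on by (intro grass_ball_step[of "U n"]) auto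
      moreover have "0 \<le> \<nu>1 / 4 * t n * (norm (D n))^2" using s Suc \<nu>1_pos by simp
      then have "energy K (U (Suc n)) \<le> E0" using s Suc by linarith
      moreover from this have "grass_class (U (Suc n)) \<in> level_set K E0"
        using mem_level_set_iff[OF on] by blast
      ultimately show ?case using on level_subset by auto
    qed
    note s = step'[OF inv[THEN conjunct1] inv[THEN conjunct2, THEN conjunct1]]
    have "compact (energy K ` (stiefel :: (real^'n^'g) set))"
      by (intro compact_continuous_image compact_stiefel continuous_on_energy smooth_enough)
    then obtain b where b: "\<And>V :: real^'n^'g. V \<in> stiefel \<Longrightarrow> b \<le> energy K V"
      using compact_imp_bounded bounded_imp_bdd_below unfolding bdd_below_def by (metis imageI)
    have "(\<lambda>n. \<nu>1 / 4 * t n * (norm (D n))^2) \<longlonglongrightarrow> 0"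
    proof (rule decreasing_bounded_below_increments_tendsto_0)
      show "0 \<le> \<nu>1 / 4 * t n * (norm (D n))^2" for n using s[of n] \<nu>1_pos by simp
      show "energy K (U (Suc n)) \<le> energy K (U n) - \<nu>1 / 4 * t n * (norm (D n))^2" for n
        using s[of n] by blast
      show "b \<le> energy K (U n)" for n using b inv by blast
    qed
    from tendsto_mult_left[OF this, of "4 / \<nu>1"]
    have a: "(\<lambda>n. t n * (norm (D n))^2) \<longlonglongrightarrow> 0"
      using \<nu>1_pos by (simp add: field_simps)
    \<comment> \<open>The first summand equals the norm of D n after a truncated step, the second dominates it after
        a step of size at least 1/2.\<close>
    have "(\<lambda>n. t n * (norm (D n))^2 / \<theta> + sqrt (2 * (t n * (norm (D n))^2))) \<longlonglongrightarrow> 0 / \<theta> + sqrt (2 * 0)"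
      by (intro tendsto_intros a) (use par in auto)
    then have "(\<lambda>n. 2 * \<Lambda> * (t n * (norm (D n))^2 / \<theta> + sqrt (2 * (t n * (norm (D n))^2)))) \<longlonglongrightarrow> 0"
      using tendsto_mult_left[of _ 0 _ "2 * \<Lambda>"] by simp
    then show ?thesis
    proof (rule Lim_null_comparison[rotated], intro always_eventually allI)
      fix n
      have nn: "0 \<le> t n * (norm (D n))^2" using s[of n] by simp
      have "norm (D n) \<le> t n * (norm (D n))^2 / \<theta> + sqrt (2 * (t n * (norm (D n))^2))"
      proof (cases "1/2 \<le> t n")
        case True
        then have "1 * (norm (D n))^2 \<le> (2 * t n) * (norm (D n))^2"
          by (intro mult_right_mono) auto
        then have "norm (D n) \<le> sqrt (2 * (t n * (norm (D n))^2))"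
          by (intro real_le_rsqrt) (simp add: mult.assoc)
        then show ?thesis using nn par by (simp add: add_increasing)
      next
        case False
        then have "t n * norm (D n) = \<theta>" using s[of n] by blast
        then have "t n * (norm (D n))^2 / \<theta> = norm (D n)"
          using par(3) by (simp add: power2_eq_square mult.assoc[symmetric])
        then show ?thesis using nn by simp
      qed
      then have "2 * \<Lambda> * norm (D n) \<le> 2 * \<Lambda> * (t n * (norm (D n))^2 / \<theta> + sqrt (2 * (t n * (norm (D n))^2)))"
        using par by (intro mult_left_mono) auto
      then show "norm (norm (grad_G K (U n))) \<le> 2 * \<Lambda> * (t n * (norm (D n))^2 / \<theta> + sqrt (2 * (t n * (norm (D n))^2)))"
        using s[of n] by simp
    qed
  qed
  \<comment> \<open>A stopped sequence repeats its last iterate, so a zero at n = 0 recurs at n = 1.\<close>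
  have zero: "\<exists>n>0. norm (grad_G K (U n)) = 0"
    if seq: "newton_sequence K ortho 0 \<gamma>1 \<gamma>2 q \<eta> (\<lambda>_. \<sigma>) (\<lambda>_. \<theta>) U0 U"
      and z: "grad_G K (U n) = 0" for U n
  proof -
    have "U (Suc n) = U n"
      using seq z unfolding newton_sequence_def by (metis norm_zero less_irrefl)
    then show ?thesis using z by (intro exI[of _ "Suc n"]) simp
  qed
  show ?thesis
    by (rule exI[of _ "\<lambda>_. \<sigma>"], rule exI[of _ "\<lambda>_. \<theta>"]) (use par main zero in blast)
qed

end
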